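(* Assume the standing assumptions in the context with case (CII). Assume moreover that for every $t'\in(0,T)$ there exist $\tilde c(t')>0$ and $\theta(t')\in(0,1)$ such that $|k_{n,j}(t)-k_{n,j}(s)|\le\tilde c(t')\,\frac{\widetilde w_n\widetilde w_j}{w_{n+j}}(t-s)^{\theta(t')}$ for all $n,j\in\mathbb N$ and $s,t\in[0,t']$. Let $\mathring u\in(\ell^1_{\widetilde w})_+$ and let $u$ be the unique (maximal) mild solution of $u'(t)=G^{(w)}u(t)+K(t,u(t))$, $u(0)=\mathring u$. Then $u$ is also a classical solution of this problem.
   Context: Let $0<T\le\infty$, $a_n\ge0$, $b_{n,j}\ge0$ with $b_{n,j}=0$ for $j\le n$, $k_{n,j}:[0,T)\to[0,\infty)$ continuous with $k_{n,j}=k_{j,n}$. For a positive sequence $v$, $\ell^1_v=\{f:\|f\|_v=\sum v_n|f_n|<\infty\}$ with componentwise order. Weight $w$: $w_n\ge n$, monotone increasing, and $\sum_{n=1}^{j-1}w_nb_{n,j}\le\kappa w_j$ for all $j\ge2$. Case (CII): $\kappa\in(0,1)$, $\alpha\in(0,1)$, $\widetilde w_n=(1+a_n)^\alpha w_n$, and for every $t'\in(0,T)$ there is $c(t')>0$ with $k_{n,j}(t)\le c(t')\widetilde w_n\widetilde w_j/w_{n+j}$ for $t\in[0,t']$. $G^{(w)}=A^{(w)}+B^{(w)}$ on $\ell^1_w$, where $A^{(w)}f=(-a_nf_n)_n$, $B^{(w)}f=(\sum_{j>n}a_jb_{n,j}f_j)_n$ on maximal domains; it generates a substochastic analytic semigroup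 $(S^{(w)}(t))_{t\ge 0}$ on $\ell^1_w$. $K(t,f)=(\tfrac12\sum_{j=1}^{n-1}k_{n-j,j}(t)f_{n-j}f_j-\sum_{j\ge1}k_{n,j}(t)f_nf_j)_n$ for $f\in\ell^1_{\widetilde w}$, with values in $\ell^1_w$. A mild solution on $[0,t_1)$ is $u\in C([0,t_1),\ell^1_{\widetilde w})$ with $u(t)=S^{(w)}(t)\mathring u+\int_0^tS^{(w)}(t-s)K(s,u(s))\,ds$; the maximal mild solution exists and is unique on some $[0,t_{\max})$. A classical solution on $[0,t_1)$ is $u:[0,t_1)\to\ell^1_{\widetilde w}$ continuous, with $u:(0,t_1)\to\ell^1_w$ continuously differentiable, $u(t)\in\mathcal D(G^{(w)})$ and $u'(t)=G^{(w)}u(t)+K(t,u(t))$ for $t\in(0,t_1)$, $u(0)=\mathring u$. *)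

theory Defs
  imports "HOL-Analysis.Analysis"
begin

text \<open>Sequences are functions nat => real; only the indices n >= 1 are meaningful
  (the value at index 0 is ignored everywhere).\<close>

definition l1 :: "(nat \<Rightarrow> real) \<Rightarrow> (nat \<Rightarrow> real) \<Rightarrow> bool" where
  "l1 v f \<longleftrightarrow> (\<lambda>n. v n * \<bar>f n\<bar>) summable_on {1..}"

definition nrm :: "(nat \<Rightarrow> real) \<Rightarrow> (nat \<Rightarrow> real) \<Rightarrow> real" where
  "nrm v f = (\<Sum>\<^sub>\<infinity>n\<in>{1..}. v n * \<bar>f n\<bar>)"

definition eqv :: "(nat \<Rightarrow> real) \<Rightarrow> (nat \<Rightarrow> real) \<Rightarrow> bool" where
  "eqv f g \<longleftrightarrow> (\<forall>n\<ge>1. f n = g n)"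

definition ncont :: "(nat \<Rightarrow> real) \<Rightarrow> real set \<Rightarrow> (real \<Rightarrow> nat \<Rightarrow> real) \<Rightarrow> bool" where
  "ncont v I u \<longleftrightarrow> (\<forall>t\<in>I. l1 v (u t)) \<and>
     (\<forall>t\<in>I. ((\<lambda>s. nrm v (\<lambda>n. u s n - u t n)) \<longlongrightarrow> 0) (at t within I))"

definition Aop :: "(nat \<Rightarrow> real) \<Rightarrow> (nat \<Rightarrow> real) \<Rightarrow> nat \<Rightarrow> real" where
  "Aop a f = (\<lambda>n. - a n * f n)"

definition Bop :: "(nat \<Rightarrow> real) \<Rightarrow> (nat \<Rightarrow> nat \<Rightarrow> real) \<Rightarrow> (nat \<Rightarrow> real) \<Rightarrow> nat \<Rightarrow> real" where
  "Bop a b f = (\<lambda>n. \<Sum>\<^sub>\<infinity>j\<in>{n<..}. a j * b n j * f j)"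

definition DA :: "(nat \<Rightarrow> real) \<Rightarrow> (nat \<Rightarrow> real) \<Rightarrow> (nat \<Rightarrow> real) set" where
  "DA w a = {f. l1 w f \<and> l1 w (Aop a f)}"

definition DB :: "(nat \<Rightarrow> real) \<Rightarrow> (nat \<Rightarrow> real) \<Rightarrow> (nat \<Rightarrow> nat \<Rightarrow> real) \<Rightarrow> (nat \<Rightarrow> real) set" where
  "DB w a b = {f. l1 w f \<and> (\<forall>n\<ge>1. (\<lambda>j. a j * b n j * f j) summable_on {n<..}) \<and> l1 w (Bop a b f)}"

definition DG :: "(nat \<Rightarrow> real) \<Rightarrow> (nat \<Rightarrow> real) \<Rightarrow> (nat \<Rightarrow> nat \<Rightarrow> real) \<Rightarrow> (nat \<Rightarrow> real) set" where
  "DG w a b = DA w a \<inter> DB w a b"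

definition Gop :: "(nat \<Rightarrow> real) \<Rightarrow> (nat \<Rightarrow> nat \<Rightarrow> real) \<Rightarrow> (nat \<Rightarrow> real) \<Rightarrow> nat \<Rightarrow> real" where
  "Gop a b f = (\<lambda>n. Aop a f n + Bop a b f n)"

definition Kop :: "(nat \<Rightarrow> nat \<Rightarrow> real \<Rightarrow> real) \<Rightarrow> real \<Rightarrow> (nat \<Rightarrow> real) \<Rightarrow> nat \<Rightarrow> real" where
  "Kop k t f = (\<lambda>n. (\<Sum>j=1..n-1. k (n-j) j t * f (n-j) * f j) / 2
                    - (\<Sum>\<^sub>\<infinity>j\<in>{1..}. k n j t * f n * f j))"

definition C0_semigroup_generated_by ::
  "(nat \<Rightarrow> real) \<Rightarrow> (real \<Rightarrow> (nat \<Rightarrow> real) \<Rightarrow> nat \<Rightarrow> real) \<Rightarrow>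
   ((nat \<Rightarrow> real) \<Rightarrow> nat \<Rightarrow> real) \<Rightarrow> (nat \<Rightarrow> real) set \<Rightarrow> bool" where
  "C0_semigroup_generated_by w S G D \<longleftrightarrow>
     (\<forall>t\<ge>0. \<forall>f. l1 w f \<longrightarrow> l1 w (S t f)) \<and>
     (\<forall>t\<ge>0. \<forall>f g c. l1 w f \<longrightarrow> l1 w g \<longrightarrow>
        eqv (S t (\<lambda>n. c * f n + g n)) (\<lambda>n. c * S t f n + S t g n)) \<and>
     (\<forall>t\<ge>0. \<exists>M. \<forall>f. l1 w f \<longrightarrow> nrm w (S t f) \<le> M * nrm w f) \<and>
     (\<forall>f. l1 w f \<longrightarrow> eqv (S 0 f) f) \<and>
     (\<forall>t\<ge>0. \<forall>s\<ge>0. \<forall>f. l1 w f \<longrightarrow> eqv (S (t + s) f) (S t (S s f))) \<and>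
     (\<forall>f. l1 w f \<longrightarrow> ncont w {0..} (\<lambda>t. S t f)) \<and>
     (\<forall>f. l1 w f \<longrightarrow>
        (f \<in> D \<longleftrightarrow> (\<exists>g. l1 w g \<and>
           ((\<lambda>h. nrm w (\<lambda>n. (S h f n - f n) / h - g n)) \<longlongrightarrow> 0) (at_right 0)))) \<and>
     (\<forall>f\<in>D. l1 w (G f) \<and>
           ((\<lambda>h. nrm w (\<lambda>n. (S h f n - f n) / h - G f n)) \<longlongrightarrow> 0) (at_right 0))"

definition interval0 :: "ereal \<Rightarrow> real set" where
  "interval0 t1 = {t. 0 \<le> t \<and> ereal t < t1}"

definition interval_open :: "ereal \<Rightarrow> real set" where
  "interval_open t1 = {t. 0 < t \<and> ereal t < t1}"

text \<open>mild solution on [0,t1); the l^1_w-valued (Bochner) integral is expressed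
  componentwise, which is legitimate since coordinate evaluation is a bounded
  linear functional on l^1_w\<close>
definition mild_solution ::
  "(nat \<Rightarrow> real) \<Rightarrow> (nat \<Rightarrow> nat \<Rightarrow> real \<Rightarrow> real) \<Rightarrow> ereal \<Rightarrow>
   (real \<Rightarrow> (nat \<Rightarrow> real) \<Rightarrow> nat \<Rightarrow> real) \<Rightarrow> (nat \<Rightarrow> real) \<Rightarrow> ereal \<Rightarrow>
   (real \<Rightarrow> nat \<Rightarrow> real) \<Rightarrow> bool" where
  "mild_solution wt k T S u0 t1 u \<longleftrightarrow>
     0 < t1 \<and> t1 \<le> T \<and> ncont wt (interval0 t1) u \<and>
     (\<forall>t\<in>interval0 t1. \<forall>n\<ge>1.
        (\<lambda>s. S (t - s) (Kop k s (u s)) n) integrable_on {0..t} \<and>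
        u t n = S t u0 n + integral {0..t} (\<lambda>s. S (t - s) (Kop k s (u s)) n))"

definition classical_solution ::
  "(nat \<Rightarrow> real) \<Rightarrow> (nat \<Rightarrow> real) \<Rightarrow> (nat \<Rightarrow> real) \<Rightarrow> (nat \<Rightarrow> nat \<Rightarrow> real) \<Rightarrow>
   (nat \<Rightarrow> nat \<Rightarrow> real \<Rightarrow> real) \<Rightarrow> (nat \<Rightarrow> real) \<Rightarrow> ereal \<Rightarrow>
   (real \<Rightarrow> nat \<Rightarrow> real) \<Rightarrow> bool" where
  "classical_solution w wt a b k u0 t1 u \<longleftrightarrow>
     ncont wt (interval0 t1) u \<and>
     (\<exists>u'. ncont w (interval_open t1) u' \<and>
        (\<forall>t\<in>interval_open t1.
           ((\<lambda>s. nrm w (\<lambda>n. (u s n - u t n) / (s - t) - u' t n)) \<longlongrightarrow> 0)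
              (at t within interval_open t1) \<and>
           u t \<in> DG w a b \<and>
           eqv (u' t) (\<lambda>n. Gop a b (u t) n + Kop k t (u t) n))) \<and>
     eqv (u 0) u0"

end

theory Submission
  imports Defs
begin

text \<open>
  Since \<open>\<parallel>B f\<parallel> \<le> \<kappa> \<parallel>A f\<parallel>\<close> in the \<open>w\<close>-norm, the generator is strictly dissipative:
  \<open>\<parallel>f - h G f\<parallel> \<ge> \<parallel>f\<parallel> + h \<delta> \<parallel>G f\<parallel>\<close> with \<open>\<delta> = (1 - \<kappa>) / (1 + \<kappa>)\<close>. Hence \<open>S\<close> is contractive
  and the time integral of \<open>\<delta> \<parallel>G S(t) f\<parallel>\<close> is at most \<open>\<parallel>f\<parallel>\<close>; as \<open>\<parallel>G S(t) f\<parallel>\<close> is non-increasing, this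
  yields the analytic smoothing bound \<open>\<delta> t \<parallel>G S(t) f\<parallel> \<le> \<parallel>f\<parallel>\<close> without any complex analysis.
  Interpolation between \<open>f\<close> and \<open>A f\<close> bounds \<open>S(t)\<close> from the \<open>w\<close>-space to the \<open>wt\<close>-space by
  \<open>C t powr (- \<alpha>)\<close>, which makes a mild solution locally Hoelder continuous in the \<open>wt\<close>-norm at positive
  times. The coagulation term is a bounded quadratic map from the \<open>wt\<close>-space to the \<open>w\<close>-space with
  Hoelder continuous coefficients, so the forcing is Hoelder continuous, and then the mild solution lies
  in the domain of the generator and is differentiable.
\<close>

section \<open>The Banach space of absolutely summable families\<close>

text \<open>The obstacle: the coagulation term is controlled only from the \<open>wt\<close>-space
  into the \<open>w\<close>-space, while \<open>u\<close> is known to be merely continuous in the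
  \<open>wt\<close>-norm, and a continuous forcing alone does not place a Duhamel integral in the
  domain of the generator. A Hoelder exponent, however small, does: each halving of the cutoff then
  gains a geometric factor, so the crude exponent \<open>(1 - \<alpha>) / 2\<close> is enough. It is
  sought only at times bounded away from 0, because the orbit of \<open>u0\<close> need not be
  Hoelder continuous at 0; every \<open>t > 0\<close> is reached by letting the cutoff
  \<open>e\<close> depend on \<open>t\<close>. Two features of the encoding shape the rest.
  Sequences are raw functions whose entry at 0 is meaningless and whose integrals are given
  componentwise, so the analysis is moved to a genuine Banach type, with the weights absorbed into
  the coordinates. And the multiplier \<open>(1 + a) powr \<alpha>\<close> linking the two norms is
  unbounded, so it is never applied to an integral itself: only its bounded truncations are, with
  constants that do not depend on the truncation.\<close>

typedef 'i ell1 = "{f :: 'i \<Rightarrow> real. (\<lambda>i. \<bar>f i\<bar>) summable_on UNIV}"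
  morphisms coord Abs_ell1
  by (rule exI[of _ "\<lambda>_. 0"]) simp

setup_lifting type_definition_ell1

lemma coord_abs_summable: "(\<lambda>i. \<bar>coord x i\<bar>) summable_on UNIV"
  using coord[of x] by simp

lemma ell1_eqI: "(\<And>i. coord x i = coord y i) \<Longrightarrow> x = y"
  by (simp add: coord_inject[symmetric] fun_eq_iff)

instantiation ell1 :: (type) real_vector
begin

lift_definition zero_ell1 :: "'a ell1" is "\<lambda>_. 0" by simp

lift_definition plus_ell1 :: "'a ell1 \<Rightarrow> 'a ell1 \<Rightarrow> 'a ell1" is "\<lambda>f g i. f i + g i"
  subgoal for f g
    by (rule summable_on_comparison_test[OF summable_on_add, of "\<lambda>i. \<bar>f i\<bar>" _ "\<lambda>i. \<bar>g i\<bar>"]) auto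
  done

lift_definition minus_ell1 :: "'a ell1 \<Rightarrow> 'a ell1 \<Rightarrow> 'a ell1" is "\<lambda>f g i. f i - g i"
  subgoal for f g
    by (rule summable_on_comparison_test[OF summable_on_add, of "\<lambda>i. \<bar>f i\<bar>" _ "\<lambda>i. \<bar>g i\<bar>"]) auto
  done

lift_definition uminus_ell1 :: "'a ell1 \<Rightarrow> 'a ell1" is "\<lambda>f i. - f i" by simp

lift_definition scaleR_ell1 :: "real \<Rightarrow> 'a ell1 \<Rightarrow> 'a ell1" is "\<lambda>c f i. c * f i"
  by (simp add: abs_mult summable_on_cmult_right)

instance
  by standard (transfer, simp add: algebra_simps)+

end

lemmas coord_simps [simp] =
  zero_ell1.rep_eq plus_ell1.rep_eq minus_ell1.rep_eq uminus_ell1.rep_eq scaleR_ell1.rep_eq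

instantiation ell1 :: (type) real_normed_vector
begin

definition norm_ell1 :: "'a ell1 \<Rightarrow> real" where
  "norm_ell1 x = (\<Sum>\<^sub>\<infinity>i. \<bar>coord x i\<bar>)"

definition dist_ell1 :: "'a ell1 \<Rightarrow> 'a ell1 \<Rightarrow> real" where
  "dist_ell1 x y = norm (x - y)"

definition sgn_ell1 :: "'a ell1 \<Rightarrow> 'a ell1" where
  "sgn_ell1 x = x /\<^sub>R norm x"

definition uniformity_ell1 :: "('a ell1 \<times> 'a ell1) filter" where
  "uniformity_ell1 = (INF e\<in>{0 <..}. principal {(x, y). dist x y < e})"

definition open_ell1 :: "'a ell1 set \<Rightarrow> bool" where
  "open_ell1 U \<longleftrightarrow> (\<forall>x\<in>U. \<forall>\<^sub>F (x', y) in uniformity. x' = x \<longrightarrow> y \<in> U)"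

instance
proof
  fix x y :: "'a ell1" and c :: real
  show "norm x = 0 \<longleftrightarrow> x = 0"
  proof
    assume "norm x = 0"
    then have "\<bar>coord x i\<bar> = 0" for i
      using nonneg_infsum_le_0D[OF _ coord_abs_summable[of x], of i]
      by (simp add: norm_ell1_def)
    then show "x = 0" by (auto intro: ell1_eqI)
  qed (simp add: norm_ell1_def)
  have "norm (x + y) \<le> (\<Sum>\<^sub>\<infinity>i. \<bar>coord x i\<bar> + \<bar>coord y i\<bar>)"
    unfolding norm_ell1_def
    using coord_abs_summable[of "x + y"]
    by (intro infsum_mono) (auto intro!: coord_abs_summable summable_on_add)
  also have "\<dots> = norm x + norm y"
    unfolding norm_ell1_def by (rule infsum_add) (auto intro: coord_abs_summable)
  finally show "norm (x + y) \<le> norm x + norm y" .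
  show "norm (c *\<^sub>R x) = \<bar>c\<bar> * norm x"
    by (simp add: norm_ell1_def abs_mult infsum_cmult_right')
qed (simp_all add: dist_ell1_def sgn_ell1_def uniformity_ell1_def open_ell1_def)

end

lemma sum_abs_coord_le_norm:
  assumes "finite F"
  shows "(\<Sum>i\<in>F. \<bar>coord x i\<bar>) \<le> norm x"
  unfolding norm_ell1_def by (rule finite_sum_le_infsum) (use assms coord_abs_summable in auto)

lemma abs_coord_le_norm: "\<bar>coord x i\<bar> \<le> norm x"
  using sum_abs_coord_le_norm[of "{i}"] by simp

lemma bounded_linear_coord: "bounded_linear (\<lambda>x. coord x i)"
  by (rule bounded_linear_intro[of _ 1]) (use abs_coord_le_norm in auto)

lemma summable_on_UNIV_if_sums_le:
  fixes f :: "'i \<Rightarrow> real"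
  assumes "\<And>F. finite F \<Longrightarrow> (\<Sum>i\<in>F. \<bar>f i\<bar>) \<le> C"
  shows "(\<lambda>i. \<bar>f i\<bar>) summable_on UNIV"
  by (rule nonneg_bdd_above_summable_on) (use assms in \<open>auto intro!: bdd_aboveI2\<close>)

lemma norm_ell1_leI:
  assumes "\<And>F. finite F \<Longrightarrow> (\<Sum>i\<in>F. \<bar>coord x i\<bar>) \<le> C"
  shows "norm x \<le> C"
  unfolding norm_ell1_def
  by (rule infsum_le_finite_sums) (use assms coord_abs_summable in auto)

instance ell1 :: (type) banach
proof
  fix X :: "nat \<Rightarrow> 'a ell1"
  assume X: "Cauchy X"
  have "convergent (\<lambda>m. coord (X m) i)" for i
    by (rule Cauchy_convergent, rule bounded_linear.Cauchy[OF bounded_linear_coord X])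
  then obtain L where L: "\<And>i. (\<lambda>m. coord (X m) i) \<longlonglongrightarrow> L i"
    unfolding convergent_def by metis
  \<comment> \<open>A bound on finite sums survives the coordinatewise limit, which turns a Cauchy
    estimate between members of \<open>X\<close> into an estimate against \<open>L\<close>. It
    serves twice: with the bound 1 to show that \<open>L\<close> is summable at all, and with
    \<open>e / 2\<close> for convergence.\<close>
  have bd: "(\<Sum>i\<in>F. \<bar>coord x i - L i\<bar>) \<le> e"
    if F: "finite F" and e: "\<And>m. m \<ge> M \<Longrightarrow> norm (x - X m) \<le> e" for F M e and x :: "'a ell1"
  proof (rule tendsto_upperbound)
    show "(\<lambda>m. \<Sum>i\<in>F. \<bar>coord x i - coord (X m) i\<bar>) \<longlonglongrightarrow> (\<Sum>i\<in>F. \<bar>coord x i - L i\<bar>)"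
      by (intro tendsto_intros L)
    have "(\<Sum>i\<in>F. \<bar>coord x i - coord (X m) i\<bar>) \<le> e" if "m \<ge> M" for m
      using sum_abs_coord_le_norm[OF F, of "x - X m"] e[OF that] by simp
    then show "\<forall>\<^sub>F m in sequentially. (\<Sum>i\<in>F. \<bar>coord x i - coord (X m) i\<bar>) \<le> e"
      by (auto simp: eventually_sequentially)
  qed simp
  obtain M where "\<And>m n. m \<ge> M \<Longrightarrow> n \<ge> M \<Longrightarrow> dist (X m) (X n) < 1"
    using X unfolding Cauchy_def by (meson zero_less_one)
  then have M: "\<And>m. m \<ge> M \<Longrightarrow> norm (X M - X m) \<le> 1"
    by (metis dist_norm less_imp_le order_refl)
  have "(\<lambda>i. \<bar>coord (X M) i - L i\<bar>) summable_on UNIV"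
    by (rule summable_on_UNIV_if_sums_le[of _ 1]) (use bd[OF _ M] in simp)
  then have "(\<lambda>i. \<bar>coord (X M) i - L i\<bar> + \<bar>coord (X M) i\<bar>) summable_on UNIV"
    by (intro summable_on_add coord_abs_summable)
  then have "(\<lambda>i. \<bar>L i\<bar>) summable_on UNIV"
    by (rule summable_on_comparison_test) auto
  then have cL: "coord (Abs_ell1 L) = L"
    by (simp add: Abs_ell1_inverse)
  have "X \<longlonglongrightarrow> Abs_ell1 L"
  proof (rule LIMSEQ_I)
    fix e :: real assume e: "e > 0"
    obtain N where N: "\<And>m n. m \<ge> N \<Longrightarrow> n \<ge> N \<Longrightarrow> dist (X m) (X n) < e / 2"
      using X e unfolding Cauchy_def by (meson half_gt_zero)
    have "norm (X n - Abs_ell1 L) < e" if "n \<ge> N" for n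
    proof -
      have "norm (X n - X m) \<le> e / 2" if "m \<ge> N" for m
        using N[OF \<open>n \<ge> N\<close> that] by (simp add: dist_norm)
      then have "(\<Sum>i\<in>F. \<bar>coord (X n) i - L i\<bar>) \<le> e / 2" if "finite F" for F
        using bd[OF that] by blast
      then have "norm (X n - Abs_ell1 L) \<le> e / 2"
        by (intro norm_ell1_leI) (simp only: cL minus_ell1.rep_eq)
      with e show ?thesis by simp
    qed
    then show "\<exists>no. \<forall>n\<ge>no. norm (X n - Abs_ell1 L) < e" by blast
  qed
  then show "convergent X" by (auto simp: convergent_def)
qed

section \<open>Dissipative semigroups and mild solutions\<close>

text \<open>Along an orbit the norm is continuous but need not be differentiable, so monotonicity is
  drawn from one-sided upper estimates. A line of small slope \<open>e\<close> gives slack; the set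
  where \<open>f\<close> stays below it contains its supremum, and the estimate there would extend
  the set further unless the supremum is \<open>b\<close>.\<close>

lemma right_Dini_nonpos_imp_le:
  fixes f :: "real \<Rightarrow> real"
  assumes ab: "a \<le> b" and cont: "continuous_on {a..b} f"
    and Dini: "\<And>t e. a \<le> t \<Longrightarrow> t < b \<Longrightarrow> e > 0 \<Longrightarrow> \<forall>\<^sub>F s in at_right t. f s \<le> f t + e * (s - t)"
  shows "f b \<le> f a"
proof (rule field_le_epsilon)
  fix e' :: real assume e': "e' > 0"
  \<comment> \<open>The summand 1 keeps the denominator positive when \<open>a = b\<close>.\<close>
  define e where "e = e' / (b - a + 1)"
  have e: "e > 0" using e' ab by (simp add: e_def)
  define A where "A = {t \<in> {a..b}. f t - e * (t - a) \<le> f a}"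
  have "closed A"
    unfolding A_def
    by (intro continuous_on_closed_Collect_le continuous_intros cont)
  moreover have "a \<in> A" using ab by (auto simp: A_def)
  moreover have bdd: "bdd_above A" by (auto simp: A_def intro: bdd_aboveI[of _ b])
  ultimately have sup: "Sup A \<in> A"
    using closed_contains_Sup by blast
  have "Sup A = b"
  proof (rule ccontr)
    assume "Sup A \<noteq> b"
    with sup have lt: "a \<le> Sup A" "Sup A < b" by (auto simp: A_def)
    have "\<forall>\<^sub>F s in at_right (Sup A). Sup A < s \<and> s < b \<and> f s \<le> f (Sup A) + e * (s - Sup A)"
      using Dini[OF lt e] eventually_at_right_real[OF lt(2)] by eventually_elim simp
    then obtain s where s: "Sup A < s" "s < b" "f s \<le> f (Sup A) + e * (s - Sup A)"
      by (metis (no_types, lifting) eventually_happens trivial_limit_at_right_real)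
    then have "s \<in> A"
      using sup by (auto simp: A_def algebra_simps)
    with s(1) bdd show False using cSup_upper by fastforce
  qed
  with sup have "f b \<le> f a + e * (b - a)" by (simp add: A_def)
  also have "e * (b - a) \<le> e'"
    using e' ab by (simp add: e_def field_simps)
  finally show "f b \<le> f a + e'" by simp
qed

lemma norm_integral_le:
  fixes f :: "real \<Rightarrow> 'a::banach"
  assumes "a \<le> b" "continuous_on {a..b} f" "\<And>x. x \<in> {a..b} \<Longrightarrow> norm (f x) \<le> e"
  shows "norm (integral {a..b} f) \<le> e * (b - a)"
  using assms by (intro integral_bound) auto

lemma norm_integral_diff_le:
  fixes f :: "real \<Rightarrow> 'a::banach"
  assumes ab: "a \<le> b" and cont: "continuous_on {a..b} f"
    and le: "\<And>x. x \<in> {a..b} \<Longrightarrow> norm (f x - c) \<le> e"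
  shows "norm (integral {a..b} f - (b - a) *\<^sub>R c) \<le> e * (b - a)"
proof -
  have "integral {a..b} (\<lambda>x. f x - c) = integral {a..b} f - (b - a) *\<^sub>R c"
    using ab cont by (subst Henstock_Kurzweil_Integration.integral_diff) (auto intro!: integrable_continuous_interval)
  then show ?thesis
    using norm_integral_le[OF ab continuous_on_diff[OF cont continuous_on_const] le] by simp
qed

lemma integral_average_tendsto:
  fixes f :: "real \<Rightarrow> 'a::banach"
  assumes cont: "continuous_on {a..b} f" and ab: "a < b"
  shows "((\<lambda>h. integral {a..a+h} f /\<^sub>R h) \<longlongrightarrow> f a) (at_right 0)"
proof (rule tendstoI)
  fix e :: real assume e: "e > 0"
  obtain d where d: "d > 0" "\<And>x. x \<in> {a..b} \<Longrightarrow> dist x a < d \<Longrightarrow> dist (f x) (f a) < e / 2"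
    using cont e ab unfolding continuous_on_iff by (metis atLeastAtMost_iff half_gt_zero less_eq_real_def)
  have "\<forall>\<^sub>F h in at_right 0. h \<in> {0<..<min d (b - a)}"
    by (rule eventually_at_right_real) (use d ab in auto)
  then show "\<forall>\<^sub>F h in at_right 0. dist (integral {a..a+h} f /\<^sub>R h) (f a) < e"
  proof eventually_elim
    case (elim h)
    have "norm (integral {a..a+h} f - (a + h - a) *\<^sub>R f a) \<le> e / 2 * (a + h - a)"
      using elim d(2)
      by (intro norm_integral_diff_le continuous_on_subset[OF cont])
        (auto simp: dist_norm less_imp_le)
    then have "norm ((integral {a..a+h} f - h *\<^sub>R f a) /\<^sub>R h) \<le> e / 2"
      using elim by (simp add: divide_simps mult.commute)
    also have "(integral {a..a+h} f - h *\<^sub>R f a) /\<^sub>R h = integral {a..a+h} f /\<^sub>R h - f a"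
      using elim by (simp add: algebra_simps)
    finally show ?case using e by (simp add: dist_norm)
  qed
qed

lemma has_integral_reflect_shift:
  fixes f :: "real \<Rightarrow> 'a::banach"
  assumes "(f has_integral i) {0..b - a}"
  shows "((\<lambda>r. f (b - r)) has_integral i) {a..b}"
proof (cases "a \<le> b")
  case True
  have "(\<lambda>x. (1 / -1) *\<^sub>R x + - ((1 / -1) *\<^sub>R b)) ` cbox 0 (b - a) = {a..b}"
    using image_diff_atLeastAtMost[of b 0 "b - a"] by simp
  then show ?thesis
    using has_integral_affinity[of f i 0 "b - a" "-1" b] assms by simp
next
  case False
  with assms show ?thesis by simp
qed

section \<open>Strongly continuous semigroups and their generators\<close>

locale C0_semigroup =
  fixes S :: "real \<Rightarrow> 'a::banach \<Rightarrow> 'a"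
  assumes bounded_linear_S: "t \<ge> 0 \<Longrightarrow> bounded_linear (S t)"
    and S_0 [simp]: "S 0 x = x"
    and S_add: "t \<ge> 0 \<Longrightarrow> s \<ge> 0 \<Longrightarrow> S (t + s) x = S t (S s x)"
    and continuous_orbit: "continuous_on {0..} (\<lambda>t. S t x)"
begin

text \<open>A relation instead of an operator with a domain: membership in the domain and the value
  of the generator travel together through sums, limits and the semigroup.\<close>

definition gen :: "'a \<Rightarrow> 'a \<Rightarrow> bool" where
  "gen x y \<longleftrightarrow> ((\<lambda>h. (S h x - x) /\<^sub>R h) \<longlongrightarrow> y) (at_right 0)"

lemma gen_unique: "gen x y \<Longrightarrow> gen x z \<Longrightarrow> y = z"
  unfolding gen_def by (rule tendsto_unique[rotated]) auto

lemma S_diff: "t \<ge> 0 \<Longrightarrow> S t (x - y) = S t x - S t y"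
  by (simp add: bounded_linear_S linear_diff bounded_linear.linear)

lemma S_plus: "t \<ge> 0 \<Longrightarrow> S t (x + y) = S t x + S t y"
  by (simp add: bounded_linear_S linear_add bounded_linear.linear)

lemma S_scaleR: "t \<ge> 0 \<Longrightarrow> S t (c *\<^sub>R x) = c *\<^sub>R S t x"
  by (simp add: bounded_linear_S linear_scale bounded_linear.linear)

lemma S_commute: "t \<ge> 0 \<Longrightarrow> s \<ge> 0 \<Longrightarrow> S t (S s x) = S s (S t x)"
  by (metis S_add add.commute)

lemma eventually_at_right_0: "\<forall>\<^sub>F h in at_right 0. (h::real) > 0"
  by (simp add: eventually_at_right_less)

lemma gen_add:
  assumes "gen x y" "gen x' y'"
  shows "gen (x + x') (y + y')"
  unfolding gen_def
proof (rule Lim_transform_eventually)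
  show "((\<lambda>h. (S h x - x) /\<^sub>R h + (S h x' - x') /\<^sub>R h) \<longlongrightarrow> y + y') (at_right 0)"
    using assms unfolding gen_def by (intro tendsto_intros)
  show "\<forall>\<^sub>F h in at_right 0. (S h x - x) /\<^sub>R h + (S h x' - x') /\<^sub>R h = (S h (x + x') - (x + x')) /\<^sub>R h"
    using eventually_at_right_0
    by eventually_elim (simp add: S_plus algebra_simps)
qed

lemma gen_scaleR:
  assumes "gen x y"
  shows "gen (c *\<^sub>R x) (c *\<^sub>R y)"
  unfolding gen_def
proof (rule Lim_transform_eventually)
  show "((\<lambda>h. c *\<^sub>R ((S h x - x) /\<^sub>R h)) \<longlongrightarrow> c *\<^sub>R y) (at_right 0)"
    using assms unfolding gen_def by (intro tendsto_intros)
  show "\<forall>\<^sub>F h in at_right 0. c *\<^sub>R ((S h x - x) /\<^sub>R h) = (S h (c *\<^sub>R x) - c *\<^sub>R x) /\<^sub>R h"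
    using eventually_at_right_0
    by eventually_elim (simp add: S_scaleR algebra_simps)
qed

lemma gen_diff:
  assumes "gen x y" "gen x' y'"
  shows "gen (x - x') (y - y')"
  using gen_add[OF assms(1) gen_scaleR[OF assms(2), of "-1"]] by simp

lemma gen_S:
  assumes "gen x y" "t \<ge> 0"
  shows "gen (S t x) (S t y)"
  unfolding gen_def
proof (rule Lim_transform_eventually)
  show "((\<lambda>h. S t ((S h x - x) /\<^sub>R h)) \<longlongrightarrow> S t y) (at_right 0)"
    using assms unfolding gen_def by (intro bounded_linear.tendsto[OF bounded_linear_S])
  show "\<forall>\<^sub>F h in at_right 0. S t ((S h x - x) /\<^sub>R h) = (S h (S t x) - S t x) /\<^sub>R h"
    using eventually_at_right_0
    by eventually_elim (simp add: S_scaleR S_diff S_commute assms)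
qed

lemma orbit_tendsto_0: "((\<lambda>h. S h x) \<longlongrightarrow> x) (at_right 0)"
proof -
  have "((\<lambda>h. S h x) \<longlongrightarrow> S 0 x) (at 0 within {0..})"
    using continuous_orbit[of x] unfolding continuous_on_def by blast
  then show ?thesis by (auto intro: tendsto_within_subset)
qed

lemma continuous_orbit_subset: "A \<subseteq> {0..} \<Longrightarrow> continuous_on A (\<lambda>t. S t x)"
  using continuous_on_subset[OF continuous_orbit] .

lemma integrable_orbit: "a \<ge> 0 \<Longrightarrow> (\<lambda>s. S s x) integrable_on {a..b}"
  by (intro integrable_continuous_interval continuous_orbit_subset) auto

lemma S_integral_orbit:
  assumes "t \<ge> 0" "h \<ge> 0"
  shows "S t (integral {0..h} (\<lambda>s. S s x)) = integral {t..t+h} (\<lambda>s. S s x)"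
proof -
  have "S t (integral {0..h} (\<lambda>s. S s x)) = integral {0..h} (S t \<circ> (\<lambda>s. S s x))"
    by (rule integral_linear[symmetric]) (use assms integrable_orbit bounded_linear_S in auto)
  also have "\<dots> = integral {0..h} ((\<lambda>s. S s x) \<circ> ((+) t))"
    by (rule integral_cong) (auto simp: S_add[symmetric] assms)
  also have "\<dots> = integral {t..t+h} (\<lambda>s. S s x)"
    by (subst integral_shift_Icc_real) (simp add: add.commute)
  finally show ?thesis .
qed

lemma gen_integral_orbit:
  assumes h: "h \<ge> 0"
  shows "gen (integral {0..h} (\<lambda>s. S s x)) (S h x - x)"
  unfolding gen_def
proof (rule Lim_transform_eventually)
  let ?I = "\<lambda>a b. integral {a..b} (\<lambda>s. S s x)"
  show "((\<lambda>t. ?I h (h + t) /\<^sub>R t - ?I 0 (0 + t) /\<^sub>R t) \<longlongrightarrow> S h x - x) (at_right 0)"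
    by (intro tendsto_diff integral_average_tendsto[where b = "h + 1"]
        integral_average_tendsto[where f = "\<lambda>s. S s x" and a = 0 and b = 1, simplified S_0]
        continuous_orbit_subset) (use h in auto)
  show "\<forall>\<^sub>F t in at_right 0. ?I h (h + t) /\<^sub>R t - ?I 0 (0 + t) /\<^sub>R t = (S t (?I 0 h) - ?I 0 h) /\<^sub>R t"
    using eventually_at_right_0
  proof eventually_elim
    case (elim t)
    \<comment> \<open>Both sides are the integral over \<open>[0, h + t]\<close>; cutting it at
      \<open>h\<close> and at \<open>t\<close> trades the shifted integral over
      \<open>[t, h + t]\<close> for two short ones at the ends, whose averages converge.\<close>
    have "?I 0 h + ?I h (h + t) = ?I 0 t + ?I t (h + t)"
      using elim h by (simp add: Henstock_Kurzweil_Integration.integral_combine integrable_orbit)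
    then show ?case
      using elim h by (simp add: S_integral_orbit algebra_simps flip: scaleR_diff_right)
  qed
qed

text \<open>The approximants are means of the orbit over \<open>[0, 1 / (n + 1)]\<close>: orbit
  integrals lie in the domain, and the means converge by strong continuity.\<close>

lemma gen_dense:
  obtains X Y where "X \<longlonglongrightarrow> x" "\<And>n. gen (X n) (Y n)"
proof
  define h :: "nat \<Rightarrow> real" where "h n = inverse (Suc n)" for n
  have "filterlim h (at_right 0) sequentially"
    unfolding h_def by (intro filterlim_inverse_at_right_top[THEN filterlim_compose] filterlim_real_sequentially[THEN filterlim_compose] filterlim_Suc)
  then show "(\<lambda>n. integral {0..0 + h n} (\<lambda>s. S s x) /\<^sub>R h n) \<longlonglongrightarrow> x"
    using integral_average_tendsto[of 0 1 "\<lambda>s. S s x"] continuous_orbit_subset[of "{0..1}"]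
    by (intro filterlim_compose[where f = h and g = "\<lambda>h. integral {0..0 + h} (\<lambda>s. S s x) /\<^sub>R h"]) auto
  show "gen (integral {0..0 + h n} (\<lambda>s. S s x) /\<^sub>R h n) ((S (h n) x - x) /\<^sub>R h n)" for n
    by (intro gen_scaleR) (use gen_integral_orbit[of "h n"] in \<open>auto simp: h_def\<close>)
qed

end

text \<open>Without the term \<open>h * \<delta> * norm y\<close> the inequality would be ordinary
  dissipativity and give contractivity only. This surplus is what pays for the smoothing.\<close>

locale dissipative_semigroup = C0_semigroup S for S :: "real \<Rightarrow> 'a::banach \<Rightarrow> 'a" +
  fixes \<delta> :: real
  assumes \<delta>_pos: "\<delta> > 0"
    and dissipative: "gen x y \<Longrightarrow> h > 0 \<Longrightarrow> norm x + h * \<delta> * norm y \<le> norm (x - h *\<^sub>R y)"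
begin

text \<open>Dissipativity is used at the new point \<open>S h x\<close>, not at \<open>x\<close>:
  the implicit Euler step \<open>S h x - h *\<^sub>R S h y\<close> leads back to \<open>x\<close> up
  to an error \<open>o(h)\<close>.\<close>

lemma eventually_norm_orbit_le:
  assumes "gen x y" "e > 0"
  shows "\<forall>\<^sub>F h in at_right 0. norm (S h x) + h * \<delta> * norm (S h y) \<le> norm x + e * h"
proof -
  have "((\<lambda>h. (S h x - x) /\<^sub>R h - S h y) \<longlongrightarrow> y - y) (at_right 0)"
    using assms(1) orbit_tendsto_0 unfolding gen_def by (intro tendsto_diff)
  then have "\<forall>\<^sub>F h in at_right 0. norm ((S h x - x) /\<^sub>R h - S h y) < e"
    using assms(2) by (auto simp: tendsto_iff dist_norm)
  with eventually_at_right_0 show ?thesis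
  proof eventually_elim
    case (elim h)
    have "norm (S h x) + h * \<delta> * norm (S h y) \<le> norm (S h x - h *\<^sub>R S h y)"
      using elim assms by (intro dissipative gen_S) auto
    also have "S h x - h *\<^sub>R S h y = x + h *\<^sub>R ((S h x - x) /\<^sub>R h - S h y)"
      using elim by (simp add: scaleR_diff_right)
    also have "norm \<dots> \<le> norm x + h * norm ((S h x - x) /\<^sub>R h - S h y)"
      using elim by (metis abs_of_pos norm_scaleR norm_triangle_ineq)
    also have "\<dots> \<le> norm x + e * h"
      using elim by simp
    finally show ?case .
  qed
qed

lemma norm_S_le_gen:
  assumes "gen x y" "t \<ge> 0"
  shows "norm (S t x) \<le> norm x"
proof -
  have "norm (S t x) \<le> norm (S 0 x)"
  proof (rule right_Dini_nonpos_imp_le[where f = "\<lambda>t. norm (S t x)" and a = 0 and b = t])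
    show "continuous_on {0..t} (\<lambda>t. norm (S t x))"
      by (intro continuous_intros continuous_orbit_subset) auto
    fix \<tau> e :: real assume \<tau>: "0 \<le> \<tau>" "\<tau> < t" "e > 0"
    have "\<forall>\<^sub>F h in at_right 0. norm (S (h + \<tau>) x) \<le> norm (S \<tau> x) + e * h"
      using eventually_norm_orbit_le[OF gen_S[OF assms(1)] \<tau>(3), OF \<tau>(1)] eventually_at_right_0
    proof eventually_elim
      case (elim h)
      then have "0 \<le> h * \<delta> * norm (S h (S \<tau> y))" using \<delta>_pos by simp
      with elim \<tau> show ?case by (simp add: S_add)
    qed
    then show "\<forall>\<^sub>F s in at_right \<tau>. norm (S s x) \<le> norm (S \<tau> x) + e * (s - \<tau>)"
      by (subst eventually_at_right_to_0) simp
  qed (use assms in auto)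
  then show ?thesis by simp
qed

lemma norm_S_le:
  assumes "t \<ge> 0"
  shows "norm (S t x) \<le> norm x"
proof -
  obtain X Y where X: "X \<longlonglongrightarrow> x" "\<And>n. gen (X n) (Y n)"
    by (rule gen_dense[of x], rule that)
  have "(\<lambda>n. norm (S t (X n))) \<longlonglongrightarrow> norm (S t x)" "(\<lambda>n. norm (X n)) \<longlonglongrightarrow> norm x"
    using X assms by (auto intro!: tendsto_norm bounded_linear.tendsto[OF bounded_linear_S])
  then show ?thesis
    by (rule LIMSEQ_le) (use norm_S_le_gen[OF X(2) assms] in auto)
qed

text \<open>The norm of the generator along an orbit is non-increasing, so its value at time \<open>t\<close> is
  at most its mean over \<open>[0, t]\<close>, which the dissipation controls.\<close>

lemma smoothing_gen:
  assumes "gen x y" "t \<ge> 0"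
  shows "\<delta> * t * norm (S t y) \<le> norm x"
proof -
  \<comment> \<open>The second summand carries \<open>norm (S t y)\<close> frozen at the final time.
    For \<open>s \<le> t\<close> this is at most \<open>norm (S s y)\<close>, so its growth in
    \<open>s\<close> is outweighed by the dissipation and the whole expression cannot increase; no
    integral has to be formed.\<close>
  have "norm (S t x) + t * (\<delta> * norm (S t y)) \<le> norm (S 0 x) + 0 * (\<delta> * norm (S t y))"
  proof (rule right_Dini_nonpos_imp_le[where f = "\<lambda>s. norm (S s x) + s * (\<delta> * norm (S t y))"
        and a = 0 and b = t])
    show "continuous_on {0..t} (\<lambda>s. norm (S s x) + s * (\<delta> * norm (S t y)))"
      by (intro continuous_intros continuous_orbit_subset) auto
    fix \<tau> e :: real assume \<tau>: "0 \<le> \<tau>" "\<tau> < t" "e > 0"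
    have "\<forall>\<^sub>F h in at_right 0. h \<in> {0<..<t - \<tau>}"
      by (rule eventually_at_right_real) (use \<tau> in auto)
    then have "\<forall>\<^sub>F h in at_right 0. norm (S (h + \<tau>) x) + (h + \<tau>) * (\<delta> * norm (S t y))
      \<le> norm (S \<tau> x) + \<tau> * (\<delta> * norm (S t y)) + e * h"
      using eventually_norm_orbit_le[OF gen_S[OF assms(1)] \<tau>(3), OF \<tau>(1)]
    proof eventually_elim
      case (elim h)
      have "norm (S t y) = norm (S (t - (h + \<tau>)) (S (h + \<tau>) y))"
        using elim \<tau> by (subst S_add[symmetric]) auto
      also have "\<dots> \<le> norm (S (h + \<tau>) y)"
        using elim by (intro norm_S_le) auto
      finally have "h * (\<delta> * norm (S t y)) \<le> h * \<delta> * norm (S (h + \<tau>) y)"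
        using elim \<delta>_pos by simp
      with elim \<tau> S_commute[of h \<tau> x] S_commute[of h \<tau> y] show ?case
        by (simp add: S_add algebra_simps)
    qed
    then show "\<forall>\<^sub>F s in at_right \<tau>. norm (S s x) + s * (\<delta> * norm (S t y))
      \<le> norm (S \<tau> x) + \<tau> * (\<delta> * norm (S t y)) + e * (s - \<tau>)"
      by (subst eventually_at_right_to_0) simp
  qed (use assms in auto)
  then have "norm (S t x) + \<delta> * t * norm (S t y) \<le> norm x" by (simp add: mult_ac)
  then show ?thesis using norm_ge_zero[of "S t x"] by linarith
qed

lemma bounded_linear_integral_orbit:
  assumes "h \<ge> 0"
  shows "bounded_linear (\<lambda>x. integral {0..h} (\<lambda>s. S s x))"
proof (rule bounded_linear_intro)
  fix x y and c :: real
  have "integral {0..h} (\<lambda>s. S s (x + y)) = integral {0..h} (\<lambda>s. S s x + S s y)"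
    by (rule integral_cong) (simp add: S_plus)
  then show "integral {0..h} (\<lambda>s. S s (x + y)) = integral {0..h} (\<lambda>s. S s x) + integral {0..h} (\<lambda>s. S s y)"
    by (simp add: Henstock_Kurzweil_Integration.integral_add integrable_orbit)
  have "integral {0..h} (\<lambda>s. S s (c *\<^sub>R x)) = integral {0..h} (\<lambda>s. c *\<^sub>R S s x)"
    by (rule integral_cong) (simp add: S_scaleR)
  then show "integral {0..h} (\<lambda>s. S s (c *\<^sub>R x)) = c *\<^sub>R integral {0..h} (\<lambda>s. S s x)"
    by simp
  show "norm (integral {0..h} (\<lambda>s. S s x)) \<le> norm x * h"
    using norm_integral_le[OF assms, of "\<lambda>s. S s x" "norm x"] norm_S_le
    by (simp add: continuous_orbit_subset)
qed

text \<open>Both sides are values of the generator at the orbit integral of \<open>x\<close>: one by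
  the formula for orbit integrals, the other because the bounded map
  \<open>x \<mapsto> integral of the orbit\<close> commutes with the semigroup. Uniqueness of the
  value makes them equal.\<close>

lemma S_minus_id_eq_integral:
  assumes xy: "gen x y" and h: "h \<ge> 0"
  shows "S h x - x = integral {0..h} (\<lambda>s. S s y)"
proof (rule gen_unique)
  let ?J = "\<lambda>x. integral {0..h} (\<lambda>s. S s x)"
  note J = bounded_linear_integral_orbit[OF h]
  show "gen (?J x) (S h x - x)" by (rule gen_integral_orbit[OF h])
  show "gen (?J x) (?J y)"
    unfolding gen_def
  proof (rule Lim_transform_eventually)
    show "((\<lambda>t. ?J ((S t x - x) /\<^sub>R t)) \<longlongrightarrow> ?J y) (at_right 0)"
      using xy unfolding gen_def by (rule bounded_linear.tendsto[OF J])
    show "\<forall>\<^sub>F t in at_right 0. ?J ((S t x - x) /\<^sub>R t) = (S t (?J x) - ?J x) /\<^sub>R t"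
      using eventually_at_right_0
    proof eventually_elim
      case (elim t)
      have "S t (?J x) = integral {0..h} (S t \<circ> (\<lambda>s. S s x))"
        by (rule integral_linear[symmetric]) (use elim integrable_orbit bounded_linear_S in auto)
      also have "\<dots> = ?J (S t x)"
        by (rule integral_cong) (use elim in \<open>simp add: S_commute\<close>)
      finally have "(S t (?J x) - ?J x) /\<^sub>R t = (?J (S t x) - ?J x) /\<^sub>R t" by simp
      also have "\<dots> = ?J (S t x - x) /\<^sub>R t"
        unfolding linear_diff[OF bounded_linear.linear[OF J], of "S t x" x] ..
      also have "\<dots> = ?J ((S t x - x) /\<^sub>R t)"
        unfolding linear_scale[OF bounded_linear.linear[OF J], of "inverse t"] ..
      finally show ?case ..
    qed
  qed
qed

lemma norm_S_minus_id_le: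
  assumes "gen x y" "h \<ge> 0"
  shows "norm (S h x - x) \<le> norm y * h"
  using norm_integral_le[OF assms(2), of "\<lambda>s. S s y" "norm y"] norm_S_le
  by (simp add: S_minus_id_eq_integral[OF assms] continuous_orbit_subset)

text \<open>The integrated identity for \<open>S h x - x\<close> involves only bounded operators, so
  it passes to the limit; averaging over \<open>h\<close> then recovers the generator.\<close>

lemma gen_closed:
  assumes gen: "\<And>n. gen (X n) (Y n)" and X: "X \<longlonglongrightarrow> x" and Y: "Y \<longlonglongrightarrow> y"
  shows "gen x y"
proof -
  have eq: "S h x - x = integral {0..h} (\<lambda>s. S s y)" if h: "h \<ge> 0" for h
  proof (rule LIMSEQ_unique)
    show "(\<lambda>n. S h (X n) - X n) \<longlonglongrightarrow> S h x - x"
      using h by (intro tendsto_diff X bounded_linear.tendsto[OF bounded_linear_S])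
    show "(\<lambda>n. S h (X n) - X n) \<longlonglongrightarrow> integral {0..h} (\<lambda>s. S s y)"
      unfolding S_minus_id_eq_integral[OF gen h]
      by (rule bounded_linear.tendsto[OF bounded_linear_integral_orbit[OF h] Y])
  qed
  show ?thesis
    unfolding gen_def
  proof (rule Lim_transform_eventually)
    show "((\<lambda>h. integral {0..0 + h} (\<lambda>s. S s y) /\<^sub>R h) \<longlongrightarrow> y) (at_right 0)"
      using integral_average_tendsto[of 0 1 "\<lambda>s. S s y"] by (simp add: continuous_orbit_subset)
    show "\<forall>\<^sub>F h in at_right 0. integral {0..0 + h} (\<lambda>s. S s y) /\<^sub>R h = (S h x - x) /\<^sub>R h"
      using eventually_at_right_0 by eventually_elim (simp add: eq)
  qed
qed

text \<open>The estimate for domain elements, applied to differences of an approximating sequence,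
  makes \<open>S t (Y n)\<close> a Cauchy sequence; closedness identifies its limit.\<close>

lemma smoothing:
  assumes t: "t > 0"
  obtains y where "gen (S t x) y" "norm y \<le> norm x / (\<delta> * t)"
proof -
  obtain X Y where X: "X \<longlonglongrightarrow> x" and gen: "\<And>n. gen (X n) (Y n)"
    by (rule gen_dense[of x], rule that)
  have \<delta>t: "\<delta> * t > 0" using t \<delta>_pos by simp
  have le: "norm (S t (Y n)) \<le> norm (X n) / (\<delta> * t)" for n
    using smoothing_gen[OF gen, of t] t \<delta>t by (simp add: pos_le_divide_eq mult.commute)
  have le2: "norm (S t (Y m) - S t (Y n)) \<le> norm (X m - X n) / (\<delta> * t)" for m n
    using smoothing_gen[OF gen_diff[OF gen gen], of t m n] t \<delta>t
    by (simp add: pos_le_divide_eq mult.commute S_diff)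
  have "Cauchy (\<lambda>n. S t (Y n))"
  proof (rule metric_CauchyI)
    fix e :: real assume "e > 0"
    then obtain M where M: "\<And>m n. m \<ge> M \<Longrightarrow> n \<ge> M \<Longrightarrow> dist (X m) (X n) < e * (\<delta> * t)"
      using LIMSEQ_imp_Cauchy[OF X] \<delta>t unfolding Cauchy_def by (meson mult_pos_pos)
    have "dist (S t (Y m)) (S t (Y n)) < e" if "m \<ge> M" "n \<ge> M" for m n
      using M[OF that] le2[of m n] \<delta>t by (simp add: dist_norm pos_le_divide_eq)
        (meson le_less_trans mult_less_cancel_right_pos)
    then show "\<exists>M. \<forall>m\<ge>M. \<forall>n\<ge>M. dist (S t (Y m)) (S t (Y n)) < e" by blast
  qed
  then obtain y where y: "(\<lambda>n. S t (Y n)) \<longlonglongrightarrow> y"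
    using Cauchy_convergent convergent_def by blast
  have "gen (S t x) y"
    by (rule gen_closed[OF gen_S[OF gen]])
      (use t y X in \<open>auto intro!: bounded_linear.tendsto[OF bounded_linear_S]\<close>)
  moreover have "norm y \<le> norm x / (\<delta> * t)"
    by (rule LIMSEQ_le[OF tendsto_norm[OF y] tendsto_divide[OF tendsto_norm[OF X] tendsto_const]])
      (use le \<delta>t in auto)
  ultimately show thesis by (rule that)
qed

text \<open>The composition of the generator with \<open>S t\<close>. For \<open>t > 0\<close>
  smoothing makes it total and bounded; for other times the description may denote nothing, hence
  the positivity premises below.\<close>

definition GS :: "real \<Rightarrow> 'a \<Rightarrow> 'a" where
  "GS t x = (THE y. gen (S t x) y)"

lemma GS_eqI: "gen (S t x) y \<Longrightarrow> GS t x = y"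
  unfolding GS_def using gen_unique by blast

lemma gen_GS: "t > 0 \<Longrightarrow> gen (S t x) (GS t x)"
  by (metis smoothing GS_eqI)

lemma norm_GS_le: "t > 0 \<Longrightarrow> norm (GS t x) \<le> norm x / (\<delta> * t)"
  by (metis smoothing GS_eqI)

lemma GS_plus: "t > 0 \<Longrightarrow> GS t (x + y) = GS t x + GS t y"
  by (rule GS_eqI) (simp add: S_plus gen_add gen_GS)

lemma continuous_on_GS:
  assumes "t > 0" "continuous_on A f"
  shows "continuous_on A (\<lambda>x. GS t (f x))"
proof -
  have "GS t (c *\<^sub>R x) = c *\<^sub>R GS t x" for c x
    by (rule GS_eqI) (use assms in \<open>simp add: S_scaleR gen_scaleR gen_GS\<close>)
  then have "bounded_linear (GS t)"
    using norm_GS_le[OF assms(1)] GS_plus[OF assms(1)]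
    by (intro bounded_linear_intro[of _ "1 / (\<delta> * t)"]) auto
  then show ?thesis
    using bounded_linear.continuous_on assms(2) by blast
qed

text \<open>Strong continuity handles the time argument for a fixed vector; contractivity makes the
  error from moving the vector uniform in time.\<close>

lemma continuous_on_S:
  assumes f: "continuous_on A f" and g: "continuous_on A g" and pos: "\<And>x. x \<in> A \<Longrightarrow> f x \<ge> 0"
  shows "continuous_on A (\<lambda>x. S (f x) (g x))"
  unfolding continuous_on_def
proof
  fix x assume x: "x \<in> A"
  have "((\<lambda>z. S (f z) (g x)) \<longlongrightarrow> S (f x) (g x)) (at x within A)"
    using continuous_on_compose2[OF continuous_orbit f, of "g x"] pos x
    by (auto simp: continuous_on_def)
  moreover have "((\<lambda>z. S (f z) (g z - g x)) \<longlongrightarrow> 0) (at x within A)"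
  proof (rule Lim_null_comparison)
    show "\<forall>\<^sub>F z in at x within A. norm (S (f z) (g z - g x)) \<le> norm (g z - g x)"
      unfolding eventually_at_filter by (rule always_eventually) (auto intro!: norm_S_le pos)
    show "((\<lambda>z. norm (g z - g x)) \<longlongrightarrow> 0) (at x within A)"
      using g x by (auto simp: continuous_on_def intro!: tendsto_norm_zero LIM_zero)
  qed
  ultimately have "((\<lambda>z. S (f z) (g z - g x) + S (f z) (g x)) \<longlongrightarrow> 0 + S (f x) (g x)) (at x within A)"
    by (intro tendsto_add)
  moreover have "\<forall>\<^sub>F z in at x within A. S (f z) (g z - g x) + S (f z) (g x) = S (f z) (g z)"
    unfolding eventually_at_filter by (rule always_eventually) (auto simp: S_diff pos)
  ultimately show "((\<lambda>z. S (f z) (g z)) \<longlongrightarrow> S (f x) (g x)) (at x within A)"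
    by (simp add: filterlim_cong)
qed

section \<open>Duhamel integrals and mild evolution\<close>

lemma continuous_on_Duhamel:
  assumes "continuous_on {a..b} g" "b \<le> t"
  shows "continuous_on {a..b} (\<lambda>r. S (t - r) (g r))"
  by (intro continuous_on_S continuous_intros assms) (use assms in auto)

lemma S_Duhamel:
  assumes "continuous_on {a..b} g" "b \<le> t" "h \<ge> 0"
  shows "S h (integral {a..b} (\<lambda>r. S (t - r) (g r))) = integral {a..b} (\<lambda>r. S (t + h - r) (g r))"
proof -
  have "S h (integral {a..b} (\<lambda>r. S (t - r) (g r))) = integral {a..b} (S h \<circ> (\<lambda>r. S (t - r) (g r)))"
    by (rule integral_linear[symmetric])
      (use assms bounded_linear_S in \<open>auto intro!: integrable_continuous_interval continuous_on_Duhamel\<close>)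
  also have "\<dots> = integral {a..b} (\<lambda>r. S (t + h - r) (g r))"
    by (rule integral_cong) (use assms in \<open>auto simp: S_add[symmetric] algebra_simps\<close>)
  finally show ?thesis .
qed

text \<open>Duhamel's formula restarted from every intermediate time, so that later estimates can
  begin at a positive time and never refer to the initial value.\<close>

definition evolves :: "real \<Rightarrow> (real \<Rightarrow> 'a) \<Rightarrow> (real \<Rightarrow> 'a) \<Rightarrow> bool" where
  "evolves \<tau> g u \<longleftrightarrow> (\<forall>s t. 0 \<le> s \<longrightarrow> s \<le> t \<longrightarrow> t \<le> \<tau> \<longrightarrow>
     u t = S (t - s) (u s) + integral {s..t} (\<lambda>r. S (t - r) (g r)))"

lemma evolvesD:
  "evolves \<tau> g u \<Longrightarrow> 0 \<le> s \<Longrightarrow> s \<le> t \<Longrightarrow> t \<le> \<tau> \<Longrightarrow>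
    u t = S (t - s) (u s) + integral {s..t} (\<lambda>r. S (t - r) (g r))"
  unfolding evolves_def by blast

lemma evolves_if_mild:
  assumes g: "continuous_on {0..\<tau>} g"
    and u: "\<And>t. 0 \<le> t \<Longrightarrow> t \<le> \<tau> \<Longrightarrow> u t = S t x + integral {0..t} (\<lambda>r. S (t - r) (g r))"
  shows "evolves \<tau> g u"
  unfolding evolves_def
proof (intro allI impI)
  fix s t assume st: "0 \<le> s" "s \<le> t" "t \<le> \<tau>"
  have g': "continuous_on {0..t} g" "continuous_on {0..s} g"
    by (rule continuous_on_subset[OF g], use st in auto)+
  have "S (t - s) (u s) = S t x + integral {0..s} (\<lambda>r. S (t - r) (g r))"
    using st by (simp add: u S_plus S_Duhamel[OF g'(2)] flip: S_add)
  moreover have "integral {0..s} (\<lambda>r. S (t - r) (g r)) + integral {s..t} (\<lambda>r. S (t - r) (g r))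
      = integral {0..t} (\<lambda>r. S (t - r) (g r))"
    using st g' by (intro Henstock_Kurzweil_Integration.integral_combine integrable_continuous_interval
        continuous_on_Duhamel) auto
  ultimately show "u t = S (t - s) (u s) + integral {s..t} (\<lambda>r. S (t - r) (g r))"
    using st by (simp add: u add.assoc)
qed

section \<open>Fractional regularity gained from the semigroup\<close>

text \<open>Abstractly, \<open>\<Lambda>\<close> is of order \<open>\<alpha>\<close> relative to the generator; the bound is the Young form
  (with free parameter \<open>r\<close>) of an interpolation inequality.\<close>

definition interpolating :: "('a \<Rightarrow> 'a) \<Rightarrow> real \<Rightarrow> real \<Rightarrow> bool" where
  "interpolating \<Lambda> L \<alpha> \<longleftrightarrow> bounded_linear \<Lambda> \<and>
     (\<forall>x y r. gen x y \<longrightarrow> r \<ge> 1 \<longrightarrow> norm (\<Lambda> x) \<le> L * (r powr \<alpha> * norm x + r powr (\<alpha> - 1) * norm y))"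

lemma interpolating_S:
  assumes \<Lambda>: "interpolating \<Lambda> L \<alpha>" and L: "L \<ge> 0" and t: "0 < t" "t \<le> 1"
  shows "norm (\<Lambda> (S t x)) \<le> L * (1 + 1 / \<delta>) * t powr - \<alpha> * norm x"
proof -
  obtain y where y: "gen (S t x) y" "norm y \<le> norm x / (\<delta> * t)"
    using smoothing[OF t(1)] by blast
  \<comment> \<open>The parameter is \<open>r = 1 / t\<close>, admissible because
    \<open>t \<le> 1\<close>; it balances the two terms, as the generator at \<open>S t x\<close>
    costs a factor \<open>1 / t\<close>.\<close>
  have p: "(1 / t) powr \<alpha> = t powr - \<alpha>" "(1 / t) powr (\<alpha> - 1) = t powr - \<alpha> * t"
    using t by (simp_all add: powr_divide powr_minus powr_diff field_simps)
  have "norm (\<Lambda> (S t x)) \<le> L * ((1 / t) powr \<alpha> * norm (S t x) + (1 / t) powr (\<alpha> - 1) * norm y)"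
    using \<Lambda> y t unfolding interpolating_def by auto
  also have "\<dots> \<le> L * (t powr - \<alpha> * norm x + t powr - \<alpha> * t * (norm x / (\<delta> * t)))"
    unfolding p using L y t by (intro mult_left_mono add_mono norm_S_le) auto
  also have "\<dots> = L * (1 + 1 / \<delta>) * t powr - \<alpha> * norm x"
    using t \<delta>_pos by (simp add: field_simps)
  finally show ?thesis .
qed

lemma interpolating_Duhamel:
  assumes \<Lambda>: "interpolating \<Lambda> L \<alpha>" and L: "L \<ge> 0" and \<alpha>: "\<alpha> < 1"
    and st: "s \<le> t" "t - s \<le> 1"
    and g: "continuous_on {s..t} g" "\<And>r. r \<in> {s..t} \<Longrightarrow> norm (g r) \<le> M"
  shows "norm (\<Lambda> (integral {s..t} (\<lambda>r. S (t - r) (g r))))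
    \<le> L * (1 + 1 / \<delta>) * M * ((t - s) powr (1 - \<alpha>) / (1 - \<alpha>))"
proof -
  define C where "C = L * (1 + 1 / \<delta>)"
  have C: "C \<ge> 0" using L \<delta>_pos by (simp add: C_def)
  \<comment> \<open>Since \<open>0 powr x = 0\<close>, the majorant vanishes at
    \<open>r = t\<close>, where the original integrand need not. Resetting the integrand at this
    single point leaves the integral alone and makes the bound hold everywhere.\<close>
  define \<psi> where "\<psi> r = (if r = t then 0 else \<Lambda> (S (t - r) (g r)))" for r
  have "bounded_linear \<Lambda>" using \<Lambda> by (simp add: interpolating_def)
  then have "((\<lambda>r. \<Lambda> (S (t - r) (g r))) has_integral \<Lambda> (integral {s..t} (\<lambda>r. S (t - r) (g r)))) {s..t}"
    using has_integral_linear[OF integrable_integral[OF integrable_continuous_interval[OF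
          continuous_on_Duhamel[OF g(1) order_refl]]]]
    by (simp add: o_def)
  then have i1: "(\<psi> has_integral \<Lambda> (integral {s..t} (\<lambda>r. S (t - r) (g r)))) {s..t}"
    by (rule has_integral_spike_finite[rotated 2, of _ _ _ "{t}"]) (auto simp: \<psi>_def)
  have "((\<lambda>r. r powr - \<alpha>) has_integral ((t - s) powr (- \<alpha> + 1) / (- \<alpha> + 1))) {0..t - s}"
    by (rule has_integral_powr_from_0) (use \<alpha> st in auto)
  from has_integral_mult_right[OF has_integral_reflect_shift[OF this], of "C * M"]
  have i2: "((\<lambda>r. C * M * (t - r) powr - \<alpha>) has_integral (C * M * ((t - s) powr (1 - \<alpha>) / (1 - \<alpha>)))) {s..t}"
    by (simp add: add.commute)
  have "norm (\<psi> r) \<le> C * M * (t - r) powr - \<alpha>" if r: "r \<in> {s..t}" for r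
  proof (cases "r = t")
    case False
    then have "norm (\<psi> r) \<le> C * (t - r) powr - \<alpha> * norm (g r)"
      using interpolating_S[OF \<Lambda> L, of "t - r" "g r"] r st by (simp add: \<psi>_def C_def)
    also have "\<dots> \<le> C * (t - r) powr - \<alpha> * M"
      using g(2)[OF r] C by (intro mult_left_mono) auto
    finally show ?thesis by (simp add: mult_ac)
  qed (simp add: \<psi>_def)
  then have "norm (integral {s..t} \<psi>) \<le> integral {s..t} (\<lambda>r. C * M * (t - r) powr - \<alpha>)"
    by (rule integral_norm_bound_integral[OF has_integral_integrable[OF i1] has_integral_integrable[OF i2]])
  from this[unfolded integral_unique[OF i1] integral_unique[OF i2]] show ?thesis
    by (simp only: C_def)
qed

text \<open>The waiting time \<open>d\<close> is spent in two halves: the first puts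
  \<open>x\<close> into the domain, so that the increment over \<open>h\<close> is linear in
  \<open>h\<close>; the second absorbs \<open>\<Lambda>\<close>.\<close>

lemma interpolating_S_increment:
  assumes \<Lambda>: "interpolating \<Lambda> L \<alpha>" and L: "L \<ge> 0" and d: "0 < d" "d \<le> 1" and h: "h \<ge> 0"
  shows "norm (\<Lambda> (S (h + d) x - S d x))
    \<le> L * (1 + 1 / \<delta>) * (d / 2) powr - \<alpha> * (norm x / (\<delta> * (d / 2)) * h)"
proof -
  have C: "L * (1 + 1 / \<delta>) * (d / 2) powr - \<alpha> \<ge> 0" using L \<delta>_pos by simp
  let ?z = "S h (S (d / 2) x) - S (d / 2) x"
  have "S (h + d) x = S (d / 2) (S h (S (d / 2) x))" "S d x = S (d / 2) (S (d / 2) x)"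
    using d h by (simp_all add: add.commute flip: S_add)
  then have "S (h + d) x - S d x = S (d / 2) ?z"
    using d by (simp add: S_diff)
  also have "norm (\<Lambda> (S (d / 2) ?z)) \<le> L * (1 + 1 / \<delta>) * (d / 2) powr - \<alpha> * norm ?z"
    using interpolating_S[OF \<Lambda> L, of "d / 2"] d by simp
  also have "\<dots> \<le> L * (1 + 1 / \<delta>) * (d / 2) powr - \<alpha> * (norm x / (\<delta> * (d / 2)) * h)"
  proof (rule mult_left_mono[OF _ C])
    have "norm ?z \<le> norm (GS (d / 2) x) * h"
      using d h by (intro norm_S_minus_id_le gen_GS) auto
    also have "\<dots> \<le> norm x / (\<delta> * (d / 2)) * h"
      using d h by (intro mult_right_mono norm_GS_le) auto
    finally show "norm ?z \<le> norm x / (\<delta> * (d / 2)) * h" .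
  qed
  finally show ?thesis .
qed

text \<open>For an increment of length \<open>h = d\<^sup>2\<close> the Duhamel integral is split at distance \<open>d\<close> from its
  endpoint: the analytic part contributes \<open>h * d powr (- 1 - \<alpha>)\<close> and the tail
  \<open>d powr (1 - \<alpha>)\<close>, so both are of order \<open>h powr ((1 - \<alpha>) / 2)\<close>.\<close>

lemma interpolating_Hoelder:
  assumes \<Lambda>: "interpolating \<Lambda> L \<alpha>" and L: "L \<ge> 0" and \<alpha>: "0 < \<alpha>" "\<alpha> < 1"
    and ev: "evolves \<tau> g u" and g: "continuous_on {0..\<tau>} g"
    and M: "\<And>t. t \<in> {0..\<tau>} \<Longrightarrow> norm (u t) \<le> M" "\<And>t. t \<in> {0..\<tau>} \<Longrightarrow> norm (g t) \<le> M"
    and d: "0 < d" "d \<le> 1 / 2" and t: "d \<le> t" "t + d\<^sup>2 \<le> \<tau>"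
  shows "norm (\<Lambda> (u (t + d\<^sup>2) - u t))
    \<le> L * (1 + 1 / \<delta>) * M * (4 / \<delta> + 3 / (1 - \<alpha>)) * d powr (1 - \<alpha>)"
proof -
  define C where "C = L * (1 + 1 / \<delta>)"
  have C: "C \<ge> 0" using L \<delta>_pos by (simp add: C_def)
  have "0 \<le> norm (u t)" "norm (u t) \<le> M" using t d by (auto intro!: M(1)) (smt (verit) zero_le_power2)
  then have M0: "M \<ge> 0" by linarith
  have "d\<^sup>2 \<le> d" using d by (simp add: power2_eq_square)
  \<comment> \<open>\<open>d \<le> 1 / 2\<close> keeps the length \<open>d + d\<^sup>2\<close> of
    the longest Duhamel tail below 1, the range of the short-time estimate.\<close>
  then have d2: "0 \<le> d\<^sup>2" "d\<^sup>2 \<le> d" "d\<^sup>2 + d \<le> 1" using d by auto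
  define x where "x = u (t - d)"
  define I where "I b = integral {t - d..b} (\<lambda>r. S (b - r) (g r))" for b
  have "u (t + d\<^sup>2) = S (t + d\<^sup>2 - (t - d)) x + I (t + d\<^sup>2)" "u t = S (t - (t - d)) x + I t"
    unfolding x_def I_def by (rule evolvesD[OF ev]; use t d d2 in linarith)+
  then have eq: "u (t + d\<^sup>2) - u t = (S (d\<^sup>2 + d) x - S d x) + I (t + d\<^sup>2) - I t"
    by (simp add: add.commute)
  have lin: "linear \<Lambda>" using \<Lambda> by (simp add: interpolating_def bounded_linear.linear)
  have nI: "norm (\<Lambda> (I b)) \<le> C * M * ((b - (t - d)) powr (1 - \<alpha>) / (1 - \<alpha>))"
    if "t \<le> b" "b \<le> t + d\<^sup>2" for b
    unfolding I_def C_def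
    by (rule interpolating_Duhamel[OF \<Lambda> L \<alpha>(2)])
      (use that t d d2 in \<open>auto intro!: M continuous_on_subset[OF g]\<close>)
  have "norm (\<Lambda> (S (d\<^sup>2 + d) x - S d x)) \<le> C * (d / 2) powr - \<alpha> * (norm x / (\<delta> * (d / 2)) * d\<^sup>2)"
    unfolding C_def by (rule interpolating_S_increment[OF \<Lambda> L]) (use d in auto)
  also have "\<dots> \<le> C * (2 * d powr - \<alpha>) * (M / (\<delta> * (d / 2)) * d\<^sup>2)"
  proof -
    have "(d / 2) powr - \<alpha> = 2 powr \<alpha> * d powr - \<alpha>"
      using d by (simp add: powr_divide powr_minus field_simps)
    also have "\<dots> \<le> 2 * d powr - \<alpha>"
      using powr_mono[of \<alpha> 1 2] \<alpha> by (intro mult_right_mono) auto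
    finally have "(d / 2) powr - \<alpha> \<le> 2 * d powr - \<alpha>" .
    moreover have "t - d \<le> \<tau>" using t d d2 by linarith
    then have "norm x \<le> M" using M(1)[of "t - d"] t(1) by (simp add: x_def)
    then have "norm x / (\<delta> * (d / 2)) * d\<^sup>2 \<le> M / (\<delta> * (d / 2)) * d\<^sup>2"
      using d \<delta>_pos by (intro mult_right_mono divide_right_mono) auto
    ultimately show ?thesis
      using C d \<delta>_pos by (intro mult_mono[of "C * _"] mult_left_mono[of _ _ C]) auto
  qed
  also have "\<dots> = C * M * (4 / \<delta>) * d powr (1 - \<alpha>)"
    using d \<delta>_pos by (simp add: powr_diff powr_minus power2_eq_square field_simps)
  finally have n1: "norm (\<Lambda> (S (d\<^sup>2 + d) x - S d x)) \<le> C * M * (4 / \<delta>) * d powr (1 - \<alpha>)" .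
  have "(t + d\<^sup>2 - (t - d)) powr (1 - \<alpha>) \<le> (2 * d) powr (1 - \<alpha>)"
    using \<alpha> d d2 by (intro powr_mono2) auto
  also have "\<dots> \<le> 2 * d powr (1 - \<alpha>)"
    using powr_mono[of "1 - \<alpha>" 1 2] \<alpha> d by (simp add: powr_mult)
  finally have "C * M * ((t + d\<^sup>2 - (t - d)) powr (1 - \<alpha>) / (1 - \<alpha>)) \<le> C * M * (2 * d powr (1 - \<alpha>) / (1 - \<alpha>))"
    using \<alpha> C M0 by (intro mult_left_mono divide_right_mono) auto
  with nI[of "t + d\<^sup>2"] d2 have n2: "norm (\<Lambda> (I (t + d\<^sup>2))) \<le> C * M * (2 * d powr (1 - \<alpha>) / (1 - \<alpha>))"
    by linarith
  have n3: "norm (\<Lambda> (I t)) \<le> C * M * (d powr (1 - \<alpha>) / (1 - \<alpha>))"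
    using nI[of t] d2 by simp
  have "norm (\<Lambda> (u (t + d\<^sup>2) - u t))
      \<le> norm (\<Lambda> (S (d\<^sup>2 + d) x - S d x)) + norm (\<Lambda> (I (t + d\<^sup>2))) + norm (\<Lambda> (I t))"
    unfolding eq linear_diff[OF lin] linear_add[OF lin]
    by (rule order_trans[OF norm_triangle_ineq4 add_right_mono[OF norm_triangle_ineq]])
  also have "\<dots> \<le> C * M * (4 / \<delta>) * d powr (1 - \<alpha>) + C * M * (2 * d powr (1 - \<alpha>) / (1 - \<alpha>))
      + C * M * (d powr (1 - \<alpha>) / (1 - \<alpha>))"
    using n1 n2 n3 by linarith
  \<comment> \<open>The 4 is 2 from \<open>(d / 2) powr - \<alpha>\<close> times 2 from dividing by
    \<open>d / 2\<close>. The 3 is 2 for the tail of length at most \<open>2 * d\<close> plus 1 for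
    the tail of length \<open>d\<close>.\<close>
  also have "\<dots> = C * M * (4 / \<delta> + 3 / (1 - \<alpha>)) * d powr (1 - \<alpha>)"
    by (simp add: algebra_simps add_divide_distrib)
  finally show ?thesis unfolding C_def .
qed

section \<open>From Hoelder continuous forcing to the domain and differentiability\<close>

text \<open>The approximations \<open>G (S \<epsilon> (u (t - \<epsilon>))) + S \<epsilon> (g t)\<close> of \<open>G (u t) + g t\<close> change by
  \<open>O(\<epsilon> powr \<gamma>)\<close> when \<open>\<epsilon>\<close> is halved, so along \<open>\<epsilon> = \<eta> / 2 ^ k\<close> they converge uniformly, and the
  generator is closed.\<close>

lemma generator_domain_if_Hoelder:
  assumes ev: "evolves \<tau> g u" and g: "continuous_on {0..\<tau>} g" and u: "continuous_on {0..\<tau>} u"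
    and \<eta>: "0 < \<eta>" "\<eta> \<le> e" and \<gamma>: "\<gamma> > 0" and H: "H \<ge> 0"
    and Hoelder: "\<And>s t. e \<le> s \<Longrightarrow> s \<le> t \<Longrightarrow> t \<le> \<tau> \<Longrightarrow> t - s \<le> \<eta> \<Longrightarrow>
      norm (g t - g s) \<le> H * (t - s) powr \<gamma>"
  obtains z where "continuous_on {2 * e..\<tau>} z" "\<And>t. t \<in> {2 * e..\<tau>} \<Longrightarrow> gen (u t) (z t)"
proof -
  \<comment> \<open>Looking back from \<open>t \<ge> 2 * e\<close> by at most
    \<open>\<eta> \<le> e\<close> stays at times from \<open>e\<close> on, where the Hoelder bound
    is available.\<close>
  define A where "A = {2 * e..\<tau>}"
  define \<epsilon> where "\<epsilon> k = \<eta> / 2 ^ k" for k :: nat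
  have e: "e > 0" using \<eta> by linarith
  have \<epsilon>: "0 < \<epsilon> k" "\<epsilon> k \<le> \<eta>" "\<epsilon> (Suc k) = \<epsilon> k / 2" for k
    using \<eta> by (auto simp: \<epsilon>_def field_simps)
  have \<epsilon>I: "\<epsilon> k \<in> {0..\<eta>}" for k using \<epsilon>(1,2)[of k] by simp
  have powr_\<epsilon>: "\<epsilon> k powr \<gamma> = \<eta> powr \<gamma> * (2 powr - \<gamma>) ^ k" for k
  proof -
    have "(2 powr - \<gamma>) ^ k = (2 powr - \<gamma>) powr real k" by (simp add: powr_realpow)
    also have "\<dots> = 2 powr - (real k * \<gamma>)" by (simp only: powr_powr mult_minus_left mult.commute)
    also have "\<dots> = inverse ((2 ^ k) powr \<gamma>)" by (simp add: powr_minus powr_powr flip: powr_realpow)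
    finally show ?thesis using \<eta>(1) by (simp add: \<epsilon>_def powr_divide) (simp add: divide_inverse)
  qed
  define y where "y k t = GS (\<epsilon> k) (u (t - \<epsilon> k)) + S (\<epsilon> k) (g t)" for k t
  have step: "norm (y (Suc k) t - y k t) \<le> H / \<delta> * \<eta> powr \<gamma> * (2 powr - \<gamma>) ^ k" if t: "t \<in> A" for k t
  proof -
    define d where "d = \<epsilon> k / 2"
    have d: "d > 0" "\<epsilon> k = 2 * d" "2 * d \<le> \<eta>" using \<epsilon>[of k] by (auto simp: d_def)
    let ?c = "\<lambda>r. S (t - d - r)"
    have gi: "continuous_on {t - 2 * d..t - d} g"
      by (rule continuous_on_subset[OF g]) (use t d \<eta> in \<open>auto simp: A_def\<close>)
    have "u (t - d) = S (t - d - (t - 2 * d)) (u (t - 2 * d)) + integral {t - 2 * d..t - d} (\<lambda>r. ?c r (g r))"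
      by (rule evolvesD[OF ev]) (use t d \<eta> in \<open>auto simp: A_def\<close>)
    also have "integral {t - 2 * d..t - d} (\<lambda>r. ?c r (g r)) =
        integral {t - 2 * d..t - d} (\<lambda>r. ?c r (g r - g t) + ?c r (g t))"
      by (rule integral_cong) (simp add: S_diff)
    also have "\<dots> = integral {t - 2 * d..t - d} (\<lambda>r. ?c r (g r - g t)) + integral {t - 2 * d..t - d} (\<lambda>r. ?c r (g t))"
      by (intro Henstock_Kurzweil_Integration.integral_add integrable_continuous_interval
          continuous_on_Duhamel continuous_intros gi) auto
    also have "integral {t - 2 * d..t - d} (\<lambda>r. ?c r (g t)) = integral {0..d} (\<lambda>s. S s (g t))"
      by (rule integral_unique, rule has_integral_reflect_shift) (simp add: integrable_integral integrable_orbit)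
    finally have ut: "u (t - d) = S d (u (t - 2 * d)) +
        (integral {t - 2 * d..t - d} (\<lambda>r. ?c r (g r - g t)) + integral {0..d} (\<lambda>s. S s (g t)))"
      by simp
    have GS1: "GS d (S d (u (t - 2 * d))) = GS (2 * d) (u (t - 2 * d))"
      using d by (simp add: GS_def flip: S_add)
    have "GS d (integral {0..d} (\<lambda>s. S s (g t))) = S d (S d (g t) - g t)"
      by (intro GS_eqI gen_S gen_integral_orbit) (use d in auto)
    then have GS2: "GS d (integral {0..d} (\<lambda>s. S s (g t))) = S (2 * d) (g t) - S d (g t)"
      using d S_add[of d d "g t"] by (simp add: S_diff)
    have "y (Suc k) t - y k t = GS d (integral {t - 2 * d..t - d} (\<lambda>r. ?c r (g r - g t)))"
      unfolding y_def \<epsilon>(3) d(2) using d by (simp add: ut GS_plus GS1 GS2)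
    also have "norm \<dots> \<le> norm (integral {t - 2 * d..t - d} (\<lambda>r. ?c r (g r - g t))) / (\<delta> * d)"
      by (rule norm_GS_le) (use d in auto)
    also have "\<dots> \<le> H * (2 * d) powr \<gamma> * (t - d - (t - 2 * d)) / (\<delta> * d)"
    proof (intro divide_right_mono norm_integral_le continuous_on_Duhamel continuous_intros gi)
      fix r assume r: "r \<in> {t - 2 * d..t - d}"
      then have "norm (?c r (g r - g t)) \<le> norm (g r - g t)"
        by (intro norm_S_le) auto
      also have "\<dots> = norm (g t - g r)" by (rule norm_minus_commute)
      also have "\<dots> \<le> H * (t - r) powr \<gamma>"
        by (rule Hoelder) (use r t d \<eta> in \<open>auto simp: A_def\<close>)
      also have "\<dots> \<le> H * (2 * d) powr \<gamma>"
        using r d \<gamma> H by (intro mult_left_mono powr_mono2) auto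
      finally show "norm (?c r (g r - g t)) \<le> H * (2 * d) powr \<gamma>" .
    qed (use d \<delta>_pos in auto)
    also have "\<dots> = H / \<delta> * \<epsilon> k powr \<gamma>"
      using d \<delta>_pos by (simp add: field_simps)
    also have "\<epsilon> k powr \<gamma> = \<eta> powr \<gamma> * (2 powr - \<gamma>) ^ k" by (rule powr_\<epsilon>)
    finally show ?thesis by simp
  qed
  have "uniform_limit A (\<lambda>n t. \<Sum>k<n. y (Suc k) t - y k t) (\<lambda>t. \<Sum>k. y (Suc k) t - y k t) sequentially"
  proof (rule Weierstrass_m_test[OF step])
    have "2 powr - \<gamma> < 2 powr (0::real)" using \<gamma> by (intro powr_less_mono) auto
    then show "summable (\<lambda>k. H / \<delta> * \<eta> powr \<gamma> * (2 powr - \<gamma>) ^ k)"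
      by (intro summable_mult summable_geometric) auto
  qed
  then have "uniform_limit A (\<lambda>n t. y 0 t + (\<Sum>k<n. y (Suc k) t - y k t))
      (\<lambda>t. y 0 t + (\<Sum>k. y (Suc k) t - y k t)) sequentially"
    by (intro uniform_limit_intros)
  then obtain Y where Y: "uniform_limit A y Y sequentially"
    by (auto simp: sum_lessThan_telescope[of "\<lambda>k. y k _"])
  have "continuous_on A (y n)" for n
    unfolding y_def
  proof (intro continuous_intros continuous_on_GS continuous_on_S)
    show "continuous_on A (\<lambda>t. u (t - \<epsilon> n))"
      by (rule continuous_on_compose2[OF u]) (use \<eta> \<epsilon>[of n] in \<open>auto simp: A_def intro!: continuous_intros\<close>)
    show "continuous_on A g"
      by (rule continuous_on_subset[OF g]) (use e in \<open>auto simp: A_def\<close>)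
  qed (use \<epsilon>[of n] in auto)
  then have contY: "continuous_on A Y"
    by (intro uniform_limit_theorem[OF _ Y]) auto
  have \<epsilon>0: "\<epsilon> \<longlonglongrightarrow> 0"
    using tendsto_mult_right_zero[OF LIMSEQ_inverse_realpow_zero[of 2], of \<eta>] by (simp add: \<epsilon>_def [abs_def] divide_inverse)
  have "gen (u t) (Y t - g t)" if t: "t \<in> A" for t
  proof (rule gen_closed)
    show "gen (S (\<epsilon> n) (u (t - \<epsilon> n))) (y n t - S (\<epsilon> n) (g t))" for n
      using gen_GS[OF \<epsilon>(1)] by (simp add: y_def)
    have "continuous_on {0..\<eta>} (\<lambda>d. S d (u (t - d)))"
      by (intro continuous_on_S continuous_on_compose2[OF u] continuous_intros) (use \<eta> t in \<open>auto simp: A_def\<close>)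
    from continuous_on_tendsto_compose[OF this \<epsilon>0] show "(\<lambda>n. S (\<epsilon> n) (u (t - \<epsilon> n))) \<longlonglongrightarrow> u t"
      using \<eta>(1) \<epsilon>I by simp
    have "(\<lambda>n. S (\<epsilon> n) (g t)) \<longlonglongrightarrow> S 0 (g t)"
      by (rule continuous_on_tendsto_compose[OF continuous_orbit \<epsilon>0]) (use \<epsilon>I in auto)
    then show "(\<lambda>n. y n t - S (\<epsilon> n) (g t)) \<longlonglongrightarrow> Y t - g t"
      using tendsto_uniform_limitI[OF Y t] by (intro tendsto_diff) auto
  qed
  moreover have "continuous_on A (\<lambda>t. Y t - g t)"
    by (intro continuous_intros contY continuous_on_subset[OF g]) (use e in \<open>auto simp: A_def\<close>)
  ultimately show thesis using that A_def by blast
qed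

text \<open>An increment of \<open>u\<close> is an orbit integral of \<open>z\<close> at the earlier
  time plus a Duhamel integral of \<open>g\<close>. Over a short interval both integrands stay close
  to \<open>z t\<close> and \<open>g t\<close>, so no derivative of the integrals is needed.\<close>

lemma derivative_if_generator_domain:
  assumes ev: "evolves \<tau> g u" and g: "continuous_on {0..\<tau>} g" and e: "e \<ge> 0"
    and z: "continuous_on {e..\<tau>} z" "\<And>t. t \<in> {e..\<tau>} \<Longrightarrow> gen (u t) (z t)" and t: "t \<in> {e..\<tau>}"
  shows "((\<lambda>s. (u s - u t) /\<^sub>R (s - t)) \<longlongrightarrow> z t + g t) (at t within {e..\<tau>})"
proof (rule tendstoI)
  fix \<eta> :: real assume \<eta>: "\<eta> > 0"
  \<comment> \<open>Each of the two integrals deviates by at most \<open>2 * q\<close> per unit of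
    time, which makes \<open>\<eta> / 2\<close> in total.\<close>
  define q where "q = \<eta> / 8"
  have q: "q > 0" using \<eta> by (simp add: q_def)
  have ge: "continuous_on {e..\<tau>} g" by (rule continuous_on_subset[OF g]) (use e in auto)
  obtain d1 where d1: "d1 > 0" "\<And>s. s \<in> {e..\<tau>} \<Longrightarrow> dist s t < d1 \<Longrightarrow> dist (z s) (z t) < q"
    using z(1) t q unfolding continuous_on_iff by metis
  obtain d2 where d2: "d2 > 0" "\<And>s. s \<in> {e..\<tau>} \<Longrightarrow> dist s t < d2 \<Longrightarrow> dist (g s) (g t) < q"
    using ge t q unfolding continuous_on_iff by metis
  have orb: "\<exists>d>0. \<forall>r. 0 \<le> r \<longrightarrow> r < d \<longrightarrow> norm (S r x - x) < q" for x
  proof -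
    obtain d where "d > 0" "\<And>r. r \<in> {0..} \<Longrightarrow> dist r 0 < d \<Longrightarrow> dist (S r x) (S 0 x) < q"
      using continuous_orbit[of x] q unfolding continuous_on_iff by (metis atLeast_iff order_refl)
    then show ?thesis by (intro exI[of _ d]) (auto simp: dist_norm)
  qed
  obtain d3 where d3: "d3 > 0" "\<And>r. 0 \<le> r \<Longrightarrow> r < d3 \<Longrightarrow> norm (S r (z t) - z t) < q"
    using orb by blast
  obtain d4 where d4: "d4 > 0" "\<And>r. 0 \<le> r \<Longrightarrow> r < d4 \<Longrightarrow> norm (S r (g t) - g t) < q"
    using orb by blast
  define d where "d = Min {d1, d2, d3, d4}"
  have d: "d > 0" "d \<le> d1" "d \<le> d2" "d \<le> d3" "d \<le> d4"
    using d1 d2 d3 d4 by (auto simp: d_def)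
  have close: "norm (S r x - x0) \<le> 2 * q"
    if "r \<ge> 0" "dist x x0 < q" "norm (S r x0 - x0) < q" for r x x0
  proof -
    have "S r x - x0 = S r (x - x0) + (S r x0 - x0)" using that by (simp add: S_diff)
    also have "norm \<dots> \<le> norm (x - x0) + norm (S r x0 - x0)"
      using norm_S_le[of r "x - x0"] that by (meson add_right_mono norm_triangle_le order_trans)
    finally show ?thesis using that by (simp add: dist_norm)
  qed
  \<comment> \<open>The alternative \<open>t = a \<or> t = b\<close> covers right and left
    difference quotients together. For the left one the orbit starts at \<open>z a\<close> with
    \<open>a\<close> before \<open>t\<close>, and continuity of \<open>z\<close> is what brings it
    near \<open>z t\<close>.\<close>
  have key: "norm (u b - u a - (b - a) *\<^sub>R (z t + g t)) \<le> 4 * q * (b - a)"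
    if ab: "a \<in> {e..\<tau>}" "b \<in> {e..\<tau>}" "a \<le> b" "b - a < d" "t = a \<or> t = b" for a b
  proof -
    define I where "I = integral {a..b} (\<lambda>r. S (b - r) (g r))"
    define J where "J = integral {0..b - a} (\<lambda>r. S r (z a))"
    have "u b = S (b - a) (u a) + I"
      unfolding I_def by (rule evolvesD[OF ev]) (use ab e in auto)
    moreover have "S (b - a) (u a) - u a = J"
      unfolding J_def by (rule S_minus_id_eq_integral) (use ab z in auto)
    ultimately have "u b - u a - (b - a) *\<^sub>R (z t + g t)
        = (J - (b - a - 0) *\<^sub>R z t) + (I - (b - a) *\<^sub>R g t)"
      by (simp add: algebra_simps)
    also have "norm \<dots> \<le> 2 * q * (b - a - 0) + 2 * q * (b - a)"
    proof (rule norm_triangle_mono)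
      have "dist (z a) (z t) < q" by (rule d1) (use ab d in \<open>auto simp: dist_real_def\<close>)
      then show "norm (J - (b - a - 0) *\<^sub>R z t) \<le> 2 * q * (b - a - 0)"
        unfolding J_def
        by (intro norm_integral_diff_le continuous_orbit_subset close d3(2)) (use ab d in auto)
      have "dist (g r) (g t) < q" if "r \<in> {a..b}" for r
        by (rule d2) (use that ab d in \<open>auto simp: dist_real_def\<close>)
      then show "norm (I - (b - a) *\<^sub>R g t) \<le> 2 * q * (b - a)"
        unfolding I_def
        by (intro norm_integral_diff_le continuous_on_Duhamel close d4(2) continuous_on_subset[OF ge])
          (use ab d in auto)
    qed
    finally show ?thesis by simp
  qed
  have "dist ((u s - u t) /\<^sub>R (s - t)) (z t + g t) < \<eta>"
    if s: "s \<in> {e..\<tau>}" "s \<noteq> t" "dist s t < d" for s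
  proof -
    have "norm (u s - u t - (s - t) *\<^sub>R (z t + g t)) \<le> 4 * q * \<bar>s - t\<bar>"
    proof (cases "s \<le> t")
      case True
      have "u s - u t - (s - t) *\<^sub>R (z t + g t) = - (u t - u s - (t - s) *\<^sub>R (z t + g t))"
        by (simp add: algebra_simps)
      then show ?thesis
        using key[of s t] True s t by (simp only: norm_minus_cancel) (simp add: dist_real_def)
    next
      case False
      then show ?thesis using key[of t s] s t by (simp add: dist_real_def)
    qed
    moreover have "(u s - u t) /\<^sub>R (s - t) - (z t + g t) = (u s - u t - (s - t) *\<^sub>R (z t + g t)) /\<^sub>R (s - t)"
      using s by (simp add: scaleR_diff_right)
    ultimately have "norm ((u s - u t) /\<^sub>R (s - t) - (z t + g t)) \<le> 4 * q"
      using s by (simp add: divide_simps mult.commute)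
    then show ?thesis using \<eta> by (simp add: dist_norm q_def)
  qed
  then show "\<forall>\<^sub>F s in at t within {e..\<tau>}. dist ((u s - u t) /\<^sub>R (s - t)) (z t + g t) < \<eta>"
    unfolding eventually_at using d(1) by blast
qed

end

section \<open>Weighted sequence spaces and the coagulation operator\<close>

text \<open>Multiplying by the weight turns each weighted space, modulo the entry at 0,
  isometrically into the same unweighted type \<open>nat ell1\<close>, so that both \<open>w\<close>
  and \<open>wt\<close> are served by one Banach space.\<close>

locale weight =
  fixes v :: "nat \<Rightarrow> real"
  assumes weight_pos: "n \<ge> 1 \<Longrightarrow> v n > 0"
begin

text \<open>Indices are shifted by one because the entry at 0 of a sequence is meaningless.\<close>

definition emb :: "(nat \<Rightarrow> real) \<Rightarrow> nat ell1" where
  "emb f = Abs_ell1 (\<lambda>n. v (Suc n) * f (Suc n))"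

text \<open>Right inverse of \<open>emb\<close>. At \<open>n = 0\<close> truncated subtraction
  yields a junk value, which \<open>emb\<close> never reads.\<close>

definition proj :: "nat ell1 \<Rightarrow> nat \<Rightarrow> real" where
  "proj x n = coord x (n - 1) / v n"

lemma bij_betw_Suc: "bij_betw Suc UNIV {1..}"
  by (rule bij_betwI[of _ _ _ "\<lambda>n. n - 1"]) auto

lemma weight_abs: "v (Suc n) * \<bar>x\<bar> = \<bar>v (Suc n) * x\<bar>"
  using weight_pos[of "Suc n"] by (simp add: abs_mult)

lemma l1_iff: "l1 v f \<longleftrightarrow> (\<lambda>n. \<bar>v (Suc n) * f (Suc n)\<bar>) summable_on UNIV"
  unfolding l1_def
  using summable_on_reindex_bij_betw[OF bij_betw_Suc, of "\<lambda>n. v n * \<bar>f n\<bar>"]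
  by (simp only: weight_abs)

lemma nrm_eq: "nrm v f = (\<Sum>\<^sub>\<infinity>n. \<bar>v (Suc n) * f (Suc n)\<bar>)"
  unfolding nrm_def
  using infsum_reindex_bij_betw[OF bij_betw_Suc, of "\<lambda>n. v n * \<bar>f n\<bar>"]
  by (simp only: weight_abs)

lemma coord_emb: "l1 v f \<Longrightarrow> coord (emb f) n = v (Suc n) * f (Suc n)"
  unfolding emb_def l1_iff by (simp add: Abs_ell1_inverse)

lemma norm_emb: "l1 v f \<Longrightarrow> norm (emb f) = nrm v f"
  by (simp add: norm_ell1_def nrm_eq coord_emb)

lemma embI:
  assumes "\<And>n. v (Suc n) * f (Suc n) = coord x n"
  shows "l1 v f" "emb f = x"
proof -
  show l: "l1 v f" unfolding l1_iff assms by (rule coord_abs_summable)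
  show "emb f = x" by (rule ell1_eqI) (simp add: coord_emb[OF l] assms)
qed

lemma emb_cong: "eqv f g \<Longrightarrow> emb f = emb g"
  by (simp add: emb_def eqv_def)

lemma l1_proj: "l1 v (proj x)" and emb_proj [simp]: "emb (proj x) = x"
  by (rule embI; use weight_pos in \<open>simp add: proj_def less_imp_neq[symmetric]\<close>)+

lemma l1_lincomb: "l1 v f \<Longrightarrow> l1 v g \<Longrightarrow> l1 v (\<lambda>n. c * f n + g n)"
  and emb_lincomb: "l1 v f \<Longrightarrow> l1 v g \<Longrightarrow> emb (\<lambda>n. c * f n + g n) = c *\<^sub>R emb f + emb g"
  by (rule embI[where x = "c *\<^sub>R emb f + emb g"]; simp add: coord_emb algebra_simps)+

lemma l1_add: "l1 v f \<Longrightarrow> l1 v g \<Longrightarrow> l1 v (\<lambda>n. f n + g n)"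
  and emb_add: "l1 v f \<Longrightarrow> l1 v g \<Longrightarrow> emb (\<lambda>n. f n + g n) = emb f + emb g"
  using l1_lincomb[of f g 1] emb_lincomb[of f g 1] by auto

lemma l1_diff: "l1 v f \<Longrightarrow> l1 v g \<Longrightarrow> l1 v (\<lambda>n. f n - g n)"
  and emb_diff: "l1 v f \<Longrightarrow> l1 v g \<Longrightarrow> emb (\<lambda>n. f n - g n) = emb f - emb g"
  using l1_lincomb[of g f "-1"] emb_lincomb[of g f "-1"] by auto

lemma l1_divide: "l1 v f \<Longrightarrow> l1 v (\<lambda>n. f n / c)"
  and emb_divide: "l1 v f \<Longrightarrow> emb (\<lambda>n. f n / c) = emb f /\<^sub>R c"
  by (rule embI[where x = "emb f /\<^sub>R c"]; simp add: coord_emb divide_inverse)+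

lemma nrm_nonneg: "nrm v f \<ge> 0"
  unfolding nrm_eq by (rule infsum_nonneg) auto

lemma sum_le_nrm:
  assumes "l1 v f"
  shows "(\<Sum>n=1..N. v n * \<bar>f n\<bar>) \<le> nrm v f"
  unfolding nrm_def
  by (rule finite_sum_le_infsum) (use assms weight_pos in \<open>auto simp: l1_def less_imp_le\<close>)

lemma l1_leI:
  assumes "\<And>N. (\<Sum>n=1..N. v n * \<bar>f n\<bar>) \<le> C"
  shows "l1 v f" "nrm v f \<le> C"
proof -
  have le: "(\<Sum>n\<in>F. v n * \<bar>f n\<bar>) \<le> C" if F: "finite F" "F \<subseteq> {1..}" for F
  proof -
    have "F \<subseteq> {1..Max F}" using F by auto
    then have "(\<Sum>n\<in>F. v n * \<bar>f n\<bar>) \<le> (\<Sum>n=1..Max F. v n * \<bar>f n\<bar>)"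
      using weight_pos by (intro sum_mono2) (auto simp: less_imp_le)
    with assms[of "Max F"] show ?thesis by linarith
  qed
  show l: "l1 v f"
    unfolding l1_def
    by (rule nonneg_bdd_above_summable_on)
      (use weight_pos le in \<open>auto simp: less_imp_le intro!: bdd_aboveI2[where M = C]\<close>)
  show "nrm v f \<le> C"
    unfolding nrm_def by (rule infsum_le_finite_sums) (use l le in \<open>auto simp: l1_def\<close>)
qed

lemma tendsto_emb_iff:
  assumes "\<forall>\<^sub>F s in F. l1 v (f s)" "l1 v g"
  shows "((\<lambda>s. nrm v (\<lambda>n. f s n - g n)) \<longlongrightarrow> 0) F \<longleftrightarrow> ((\<lambda>s. emb (f s)) \<longlongrightarrow> emb g) F"
proof -
  have "\<forall>\<^sub>F s in F. nrm v (\<lambda>n. f s n - g n) = norm (emb (f s) - emb g)"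
    using assms(1) by eventually_elim (use assms(2) in \<open>simp add: norm_emb l1_diff flip: emb_diff\<close>)
  then have "((\<lambda>s. nrm v (\<lambda>n. f s n - g n)) \<longlongrightarrow> 0) F \<longleftrightarrow> ((\<lambda>s. norm (emb (f s) - emb g)) \<longlongrightarrow> 0) F"
    by (rule tendsto_cong)
  then show ?thesis by (simp add: tendsto_norm_zero_iff LIM_zero_iff)
qed

lemma ncont_iff: "ncont v I u \<longleftrightarrow> (\<forall>t\<in>I. l1 v (u t)) \<and> continuous_on I (\<lambda>t. emb (u t))"
proof -
  have "((\<lambda>s. nrm v (\<lambda>n. u s n - u t n)) \<longlongrightarrow> 0) (at t within I)
      \<longleftrightarrow> ((\<lambda>s. emb (u s)) \<longlongrightarrow> emb (u t)) (at t within I)"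
    if "\<forall>t\<in>I. l1 v (u t)" "t \<in> I" for t
    by (rule tendsto_emb_iff) (use that in \<open>auto simp: eventually_at_filter\<close>)
  then show ?thesis
    unfolding ncont_def continuous_on_def by blast
qed

end

lemma infsum_diff_real:
  fixes f g :: "'i \<Rightarrow> real"
  assumes "f summable_on A" "g summable_on A"
  shows "(\<Sum>\<^sub>\<infinity>x\<in>A. f x - g x) = infsum f A - infsum g A"
  using infsum_add[OF assms(1) summable_on_uminus[THEN iffD2, OF assms(2)]] by (simp add: infsum_uminus)

locale coagulation_weights = w: weight w + wt: weight wt for w wt :: "nat \<Rightarrow> real" +
  assumes w_mono: "1 \<le> n \<Longrightarrow> n \<le> m \<Longrightarrow> w n \<le> w m"
begin

text \<open>The polarised form of \<open>Kop\<close>, with a kernel that may have any sign: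
  differences in time of \<open>k\<close> and differences of either argument become instances of one
  bilinear bound.\<close>

definition Qop :: "(nat \<Rightarrow> nat \<Rightarrow> real) \<Rightarrow> (nat \<Rightarrow> real) \<Rightarrow> (nat \<Rightarrow> real) \<Rightarrow> nat \<Rightarrow> real" where
  "Qop q f g n = (\<Sum>j=1..n-1. q (n-j) j * f (n-j) * g j) / 2 - (\<Sum>\<^sub>\<infinity>j\<in>{1..}. q n j * f n * g j)"

definition dominated :: "(nat \<Rightarrow> nat \<Rightarrow> real) \<Rightarrow> real \<Rightarrow> bool" where
  "dominated q c \<longleftrightarrow> c \<ge> 0 \<and> (\<forall>n\<ge>1. \<forall>j\<ge>1. \<bar>q n j\<bar> \<le> c * (wt n * wt j / w (n + j)))"

lemma Kop_eq_Qop: "Kop k t f = Qop (\<lambda>n j. k n j t) f f"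
  by (simp add: Kop_def Qop_def fun_eq_iff)

text \<open>Monotonicity of \<open>w\<close> allows \<open>w (n + j)\<close> to be replaced by
  \<open>w n\<close>, which then cancels against the weight of the entry \<open>n\<close>; what
  remains is a product of \<open>wt\<close>-weighted terms.\<close>

lemma Qop_loss:
  assumes q: "dominated q c" and g: "l1 wt g" and n: "n \<ge> 1"
  shows "(\<lambda>j. q n j * f n * g j) summable_on {1..}"
    and "w n * \<bar>\<Sum>\<^sub>\<infinity>j\<in>{1..}. q n j * f n * g j\<bar> \<le> c * (wt n * \<bar>f n\<bar>) * nrm wt g"
proof -
  define D where "D = c * (wt n * \<bar>f n\<bar>) / w n"
  have sD: "(\<lambda>j. D * (wt j * \<bar>g j\<bar>)) summable_on {1..}"
    using g unfolding l1_def by (rule summable_on_cmult_right)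
  have le: "\<bar>q n j * f n * g j\<bar> \<le> D * (wt j * \<bar>g j\<bar>)" if j: "j \<ge> 1" for j
  proof -
    have "\<bar>q n j\<bar> \<le> c * (wt n * wt j / w (n + j))"
      using q n j by (simp add: dominated_def)
    also have "\<dots> \<le> c * (wt n * wt j / w n)"
      using q n j w_mono[of n "n + j"] w.weight_pos[of n] wt.weight_pos[of n] wt.weight_pos[of j]
      by (intro mult_left_mono divide_left_mono) (auto simp: dominated_def less_imp_le)
    finally have "\<bar>q n j\<bar> * (\<bar>f n\<bar> * \<bar>g j\<bar>) \<le> c * (wt n * wt j / w n) * (\<bar>f n\<bar> * \<bar>g j\<bar>)"
      by (rule mult_right_mono) simp
    then show ?thesis by (simp add: D_def abs_mult mult_ac)
  qed
  have abs: "(\<lambda>j. \<bar>q n j * f n * g j\<bar>) summable_on {1..}"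
    by (rule summable_on_comparison_test[OF sD]) (use le in auto)
  then show "(\<lambda>j. q n j * f n * g j) summable_on {1..}"
    using summable_on_iff_abs_summable_on_real[of "\<lambda>j. q n j * f n * g j" "{1..}"] by simp
  have "\<bar>\<Sum>\<^sub>\<infinity>j\<in>{1..}. q n j * f n * g j\<bar> \<le> (\<Sum>\<^sub>\<infinity>j\<in>{1..}. \<bar>q n j * f n * g j\<bar>)"
    using norm_infsum_bound[of "\<lambda>j. q n j * f n * g j" "{1..}"] abs by simp
  also have "\<dots> \<le> (\<Sum>\<^sub>\<infinity>j\<in>{1..}. D * (wt j * \<bar>g j\<bar>))"
    by (rule infsum_mono[OF abs sD]) (use le in auto)
  also have "\<dots> = D * nrm wt g"
    by (simp add: infsum_cmult_right' nrm_def)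
  finally have "w n * \<bar>\<Sum>\<^sub>\<infinity>j\<in>{1..}. q n j * f n * g j\<bar> \<le> w n * (D * nrm wt g)"
    using w.weight_pos[OF n] by (intro mult_left_mono) auto
  then show "w n * \<bar>\<Sum>\<^sub>\<infinity>j\<in>{1..}. q n j * f n * g j\<bar> \<le> c * (wt n * \<bar>f n\<bar>) * nrm wt g"
    using w.weight_pos[OF n] by (simp add: D_def)
qed

text \<open>The map \<open>(n, j) \<mapsto> (n - j, j)\<close> sends the triangle injectively into
  the square of index pairs.\<close>

lemma sum_convolution_le:
  fixes p r :: "nat \<Rightarrow> real"
  assumes "\<And>n. n \<ge> 1 \<Longrightarrow> p n \<ge> 0" "\<And>n. n \<ge> 1 \<Longrightarrow> r n \<ge> 0"
  shows "(\<Sum>n=1..N. \<Sum>j=1..n-1. p (n-j) * r j) \<le> (\<Sum>n=1..N. p n) * (\<Sum>n=1..N. r n)"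
proof -
  have "(\<Sum>n=1..N. \<Sum>j=1..n-1. p (n-j) * r j) = (\<Sum>(n,j)\<in>(SIGMA n:{1..N}. {1..n-1}). p (n-j) * r j)"
    by (rule sum.Sigma) auto
  also have "\<dots> = (\<Sum>(i,j)\<in>(\<lambda>(n,j). (n-j, j)) ` (SIGMA n:{1..N}. {1..n-1}). p i * r j)"
    by (subst sum.reindex) (auto simp: inj_on_def case_prod_beta)
  also have "\<dots> \<le> (\<Sum>(i,j)\<in>{1..N} \<times> {1..N}. p i * r j)"
    using assms by (intro sum_mono2) auto
  also have "\<dots> = (\<Sum>n=1..N. p n) * (\<Sum>n=1..N. r n)"
    by (simp add: sum_product sum.cartesian_product)
  finally show ?thesis .
qed

text \<open>In the gain term the indices \<open>n - j\<close> and \<open>j\<close> add up to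
  \<open>n\<close>, so the weight \<open>w n\<close> cancels the denominator of the kernel bound
  exactly. The gain contributes 1/2 and the loss 1 to the constant 3/2.\<close>

lemma Qop_bound:
  assumes q: "dominated q c" and f: "l1 wt f" and g: "l1 wt g"
  shows "l1 w (Qop q f g)" "nrm w (Qop q f g) \<le> 3 / 2 * c * nrm wt f * nrm wt g"
proof -
  have c: "c \<ge> 0" using q by (simp add: dominated_def)
  let ?p = "\<lambda>n. wt n * \<bar>f n\<bar>" and ?r = "\<lambda>n. wt n * \<bar>g n\<bar>"
  have p0: "?p n \<ge> 0" and r0: "?r n \<ge> 0" if "n \<ge> 1" for n
    using wt.weight_pos[OF that] by auto
  have gain: "w n * \<bar>\<Sum>j=1..n-1. q (n-j) j * f (n-j) * g j\<bar> \<le> c * (\<Sum>j=1..n-1. ?p (n-j) * ?r j)"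
    if n: "n \<ge> 1" for n
  proof -
    have "w n * \<bar>\<Sum>j=1..n-1. q (n-j) j * f (n-j) * g j\<bar> \<le> w n * (\<Sum>j=1..n-1. \<bar>q (n-j) j * f (n-j) * g j\<bar>)"
      using w.weight_pos[OF n] by (intro mult_left_mono sum_abs) auto
    also have "\<dots> = (\<Sum>j=1..n-1. w n * \<bar>q (n-j) j * f (n-j) * g j\<bar>)"
      by (rule sum_distrib_left)
    also have "\<dots> \<le> (\<Sum>j=1..n-1. c * (?p (n-j) * ?r j))"
    proof (rule sum_mono)
      fix j assume j: "j \<in> {1..n-1}"
      then have "\<bar>q (n-j) j\<bar> \<le> c * (wt (n-j) * wt j / w (n - j + j))"
        using q[unfolded dominated_def, THEN conjunct2, rule_format, of "n - j" j] by auto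
      moreover have "n - j + j = n" using j by auto
      ultimately have "w n * \<bar>q (n-j) j\<bar> \<le> c * (wt (n-j) * wt j)"
        using w.weight_pos[OF n] by (simp add: pos_le_divide_eq mult.commute)
      then have "w n * \<bar>q (n-j) j\<bar> * (\<bar>f (n-j)\<bar> * \<bar>g j\<bar>) \<le> c * (wt (n-j) * wt j) * (\<bar>f (n-j)\<bar> * \<bar>g j\<bar>)"
        by (rule mult_right_mono) simp
      then show "w n * \<bar>q (n-j) j * f (n-j) * g j\<bar> \<le> c * (?p (n-j) * ?r j)"
        by (simp add: abs_mult mult_ac)
    qed
    finally show ?thesis by (simp add: sum_distrib_left)
  qed
  have "(\<Sum>n=1..N. w n * \<bar>Qop q f g n\<bar>) \<le> 3 / 2 * c * nrm wt f * nrm wt g" for N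
  proof -
    have "(\<Sum>n=1..N. w n * \<bar>Qop q f g n\<bar>)
        \<le> (\<Sum>n=1..N. c / 2 * (\<Sum>j=1..n-1. ?p (n-j) * ?r j) + c * ?p n * nrm wt g)"
    proof (rule sum_mono)
      fix n assume "n \<in> {1..N}"
      then have n: "n \<ge> 1" by simp
      let ?x = "\<Sum>j=1..n-1. q (n-j) j * f (n-j) * g j" and ?y = "\<Sum>\<^sub>\<infinity>j\<in>{1..}. q n j * f n * g j"
      have "w n * \<bar>Qop q f g n\<bar> \<le> w n * (\<bar>?x\<bar> / 2 + \<bar>?y\<bar>)"
        unfolding Qop_def using w.weight_pos[OF n] by (intro mult_left_mono) auto
      then show "w n * \<bar>Qop q f g n\<bar> \<le> c / 2 * (\<Sum>j=1..n-1. ?p (n-j) * ?r j) + c * ?p n * nrm wt g"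
        using gain[OF n] Qop_loss(2)[OF q g n, of f] by (simp add: distrib_left)
    qed
    also have "\<dots> = c / 2 * (\<Sum>n=1..N. \<Sum>j=1..n-1. ?p (n-j) * ?r j) + c * (\<Sum>n=1..N. ?p n) * nrm wt g"
      by (simp only: sum.distrib sum_distrib_left sum_distrib_right)
    also have "\<dots> \<le> c / 2 * (nrm wt f * nrm wt g) + c * nrm wt f * nrm wt g"
    proof (intro add_mono mult_left_mono mult_right_mono)
      have "(\<Sum>n=1..N. \<Sum>j=1..n-1. ?p (n-j) * ?r j) \<le> (\<Sum>n=1..N. ?p n) * (\<Sum>n=1..N. ?r n)"
        by (rule sum_convolution_le[of ?p ?r]) (use p0 r0 in auto)
      also have "\<dots> \<le> nrm wt f * nrm wt g"
        by (intro mult_mono wt.sum_le_nrm f g wt.nrm_nonneg sum_nonneg) (use r0 in auto)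
      finally show "(\<Sum>n=1..N. \<Sum>j=1..n-1. ?p (n-j) * ?r j) \<le> nrm wt f * nrm wt g" .
    qed (use c wt.sum_le_nrm[OF f] wt.nrm_nonneg in auto)
    also have "\<dots> = 3 / 2 * c * nrm wt f * nrm wt g" by (simp add: field_simps)
    finally show ?thesis .
  qed
  from w.l1_leI[OF this] show "l1 w (Qop q f g)" "nrm w (Qop q f g) \<le> 3 / 2 * c * nrm wt f * nrm wt g"
    by blast+
qed

lemma Qop_diff_kernel:
  assumes "dominated q c" "dominated q' c'" "l1 wt g"
  shows "eqv (Qop (\<lambda>n j. q n j - q' n j) f g) (\<lambda>n. Qop q f g n - Qop q' f g n)"
  unfolding eqv_def
proof (intro allI impI)
  fix n :: nat assume n: "n \<ge> 1"
  have "(\<Sum>\<^sub>\<infinity>j\<in>{1..}. (q n j - q' n j) * f n * g j)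
      = (\<Sum>\<^sub>\<infinity>j\<in>{1..}. q n j * f n * g j) - (\<Sum>\<^sub>\<infinity>j\<in>{1..}. q' n j * f n * g j)"
    using infsum_diff_real[OF Qop_loss(1)[OF assms(1,3) n] Qop_loss(1)[OF assms(2,3) n], of f f]
    by (simp add: algebra_simps)
  then show "Qop (\<lambda>n j. q n j - q' n j) f g n = Qop q f g n - Qop q' f g n"
    by (simp add: Qop_def left_diff_distrib sum_subtractf diff_divide_distrib)
qed

lemma Qop_diff_left:
  assumes "dominated q c" "l1 wt g"
  shows "eqv (Qop q (\<lambda>n. f n - f' n) g) (\<lambda>n. Qop q f g n - Qop q f' g n)"
  unfolding eqv_def
proof (intro allI impI)
  fix n :: nat assume n: "n \<ge> 1"
  have "(\<Sum>\<^sub>\<infinity>j\<in>{1..}. q n j * (f n - f' n) * g j)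
      = (\<Sum>\<^sub>\<infinity>j\<in>{1..}. q n j * f n * g j) - (\<Sum>\<^sub>\<infinity>j\<in>{1..}. q n j * f' n * g j)"
    using infsum_diff_real[OF Qop_loss(1)[OF assms(1,2) n] Qop_loss(1)[OF assms(1,2) n], of f f']
    by (simp add: algebra_simps)
  then show "Qop q (\<lambda>n. f n - f' n) g n = Qop q f g n - Qop q f' g n"
    by (simp add: Qop_def left_diff_distrib right_diff_distrib sum_subtractf diff_divide_distrib)
qed

lemma Qop_diff_right:
  assumes "dominated q c" "l1 wt g" "l1 wt g'"
  shows "eqv (Qop q f (\<lambda>n. g n - g' n)) (\<lambda>n. Qop q f g n - Qop q f g' n)"
  unfolding eqv_def
proof (intro allI impI)
  fix n :: nat assume n: "n \<ge> 1"
  have "(\<Sum>\<^sub>\<infinity>j\<in>{1..}. q n j * f n * (g j - g' j))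
      = (\<Sum>\<^sub>\<infinity>j\<in>{1..}. q n j * f n * g j) - (\<Sum>\<^sub>\<infinity>j\<in>{1..}. q n j * f n * g' j)"
    using infsum_diff_real[OF Qop_loss(1)[OF assms(1,2) n] Qop_loss(1)[OF assms(1,3) n], of f f]
    by (simp add: algebra_simps)
  then show "Qop q f (\<lambda>n. g n - g' n) n = Qop q f g n - Qop q f g' n"
    by (simp add: Qop_def right_diff_distrib sum_subtractf diff_divide_distrib)
qed

text \<open>Kernel, left argument and right argument are exchanged one at a time, each at the price
  of one bilinear term; the two argument terms account for \<open>3 = 3 / 2 + 3 / 2\<close>.\<close>

lemma norm_Kop_diff_le:
  assumes k: "dominated (\<lambda>n j. k n j t) c" "dominated (\<lambda>n j. k n j s) c"
    and kd: "dominated (\<lambda>n j. k n j t - k n j s) c'"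
    and f: "l1 wt f" "nrm wt f \<le> R" and g: "l1 wt g" "nrm wt g \<le> R"
  shows "norm (w.emb (Kop k t f) - w.emb (Kop k s g)) \<le> 3 / 2 * c' * R\<^sup>2 + 3 * c * R * nrm wt (\<lambda>n. f n - g n)"
proof -
  let ?t = "\<lambda>n j. k n j t" and ?s = "\<lambda>n j. k n j s" and ?d = "\<lambda>n. f n - g n"
  have c: "c \<ge> 0" "c' \<ge> 0" using k kd by (auto simp: dominated_def)
  have R: "R \<ge> 0" using f(2) wt.nrm_nonneg[of f] by linarith
  have d: "l1 wt ?d" using f g by (intro wt.l1_diff)
  note Q = Qop_bound(1)[OF k(1) f(1) f(1)] Qop_bound(1)[OF k(2) f(1) f(1)]
    Qop_bound(1)[OF k(2) g(1) f(1)] Qop_bound(1)[OF k(2) g(1) g(1)]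
  have "w.emb (Qop (\<lambda>n j. k n j t - k n j s) f f) = w.emb (Qop ?t f f) - w.emb (Qop ?s f f)"
    using w.emb_cong[OF Qop_diff_kernel[OF k f(1), of f]] w.emb_diff[OF Q(1,2)] by simp
  moreover have "w.emb (Qop ?s ?d f) = w.emb (Qop ?s f f) - w.emb (Qop ?s g f)"
    using w.emb_cong[OF Qop_diff_left[OF k(2) f(1), of f g]] w.emb_diff[OF Q(2,3)] by simp
  moreover have "w.emb (Qop ?s g ?d) = w.emb (Qop ?s g f) - w.emb (Qop ?s g g)"
    using w.emb_cong[OF Qop_diff_right[OF k(2) f(1) g(1), of g]] w.emb_diff[OF Q(3,4)] by simp
  ultimately have eq: "w.emb (Kop k t f) - w.emb (Kop k s g)
      = w.emb (Qop (\<lambda>n j. k n j t - k n j s) f f) + w.emb (Qop ?s ?d f) + w.emb (Qop ?s g ?d)"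
    by (simp add: Kop_eq_Qop)
  have "norm (w.emb (Kop k t f) - w.emb (Kop k s g))
      \<le> norm (w.emb (Qop (\<lambda>n j. k n j t - k n j s) f f)) + norm (w.emb (Qop ?s ?d f))
        + norm (w.emb (Qop ?s g ?d))"
    unfolding eq by (rule order_trans[OF norm_triangle_ineq add_right_mono[OF norm_triangle_ineq]])
  also have "\<dots> \<le> 3 / 2 * c' * nrm wt f * nrm wt f + 3 / 2 * c * nrm wt ?d * nrm wt f
      + 3 / 2 * c * nrm wt g * nrm wt ?d"
    unfolding w.norm_emb[OF Qop_bound(1)[OF kd f(1) f(1)]] w.norm_emb[OF Qop_bound(1)[OF k(2) d f(1)]]
      w.norm_emb[OF Qop_bound(1)[OF k(2) g(1) d]]
    by (rule add_mono[OF add_mono[OF Qop_bound(2)[OF kd f(1) f(1)] Qop_bound(2)[OF k(2) d f(1)]]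
          Qop_bound(2)[OF k(2) g(1) d]])
  also have "\<dots> \<le> 3 / 2 * c' * R * R + 3 / 2 * c * nrm wt ?d * R + 3 / 2 * c * R * nrm wt ?d"
  proof (intro add_mono)
    show "3 / 2 * c' * nrm wt f * nrm wt f \<le> 3 / 2 * c' * R * R"
      unfolding mult.assoc[of "3 / 2 * c'"] using c R f(2) wt.nrm_nonneg[of f]
      by (intro mult_left_mono mult_mono) auto
    show "3 / 2 * c * nrm wt ?d * nrm wt f \<le> 3 / 2 * c * nrm wt ?d * R"
      using c f(2) wt.nrm_nonneg[of ?d] by (intro mult_left_mono) auto
    show "3 / 2 * c * nrm wt g * nrm wt ?d \<le> 3 / 2 * c * R * nrm wt ?d"
      using c g(2) wt.nrm_nonneg[of ?d] by (intro mult_right_mono mult_left_mono) auto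
  qed
  also have "\<dots> = 3 / 2 * c' * R\<^sup>2 + 3 * c * R * nrm wt ?d"
    by (simp add: power2_eq_square)
  finally show ?thesis .
qed

end

section \<open>The fragmentation semigroup\<close>

locale fragmentation = w: weight w for w :: "nat \<Rightarrow> real" +
  fixes a :: "nat \<Rightarrow> real" and b :: "nat \<Rightarrow> nat \<Rightarrow> real" and \<kappa> :: real
  assumes a_nonneg: "n \<ge> 1 \<Longrightarrow> a n \<ge> 0"
    and b_nonneg: "n \<ge> 1 \<Longrightarrow> j \<ge> 1 \<Longrightarrow> b n j \<ge> 0"
    and b_zero: "n \<ge> 1 \<Longrightarrow> j \<ge> 1 \<Longrightarrow> j \<le> n \<Longrightarrow> b n j = 0"
    and w_frag: "j \<ge> 2 \<Longrightarrow> (\<Sum>n=1..j-1. w n * b n j) \<le> \<kappa> * w j"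
    and kappa: "0 < \<kappa>" "\<kappa> < 1"
begin

lemma sum_frag_le:
  assumes j: "j \<ge> 1"
  shows "(\<Sum>n=1..N. w n * b n j) \<le> \<kappa> * w j"
proof -
  have "(\<Sum>n=1..N. w n * b n j) = (\<Sum>n\<in>{1..N} \<inter> {1..j-1}. w n * b n j)"
    by (rule sum.mono_neutral_right) (use b_zero j in auto)
  also have "\<dots> \<le> (\<Sum>n=1..j-1. w n * b n j)"
    by (rule sum_mono2) (use b_nonneg w.weight_pos j in \<open>auto simp: less_imp_le\<close>)
  also have "\<dots> \<le> \<kappa> * w j"
  \<comment> \<open>The hypothesis \<open>w_frag\<close> starts at 2; for \<open>j = 1\<close> the
    sum is empty.\<close>
  proof (cases "j = 1")
    case True
    then show ?thesis using kappa w.weight_pos[of 1] by simp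
  next
    case False
    then show ?thesis using w_frag[of j] j by simp
  qed
  finally show ?thesis .
qed

text \<open>Exchange the two summations: the column sums of \<open>w n * b n j\<close> are at most
  \<open>\<kappa> * w j\<close>. Only finitely many rows are summed at a time, so the exchange is
  additivity of summable families.\<close>

lemma nrm_Bop_le:
  assumes Af: "l1 w (Aop a f)"
  shows "nrm w (Bop a b f) \<le> \<kappa> * nrm w (Aop a f)"
proof (rule w.l1_leI(2))
  fix N
  let ?x = "\<lambda>n j. w n * b n j * (a j * \<bar>f j\<bar>)"
  have Aabs: "w j * \<bar>Aop a f j\<bar> = w j * (a j * \<bar>f j\<bar>)" if "j \<ge> 1" for j
    using a_nonneg[OF that] by (simp add: Aop_def abs_mult)
  have sA: "(\<lambda>j. \<kappa> * (w j * \<bar>Aop a f j\<bar>)) summable_on {1..}"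
    using Af unfolding l1_def by (rule summable_on_cmult_right)
  have x0: "0 \<le> ?x n j" if "n \<ge> 1" "j \<ge> 1" for n j
    using that a_nonneg[of j] b_nonneg[of n j] w.weight_pos[of n] by simp
  have sum_x: "(\<Sum>n=1..N. ?x n j) \<le> \<kappa> * (w j * \<bar>Aop a f j\<bar>)" if "j \<ge> 1" for j N
  proof -
    have "(\<Sum>n=1..N. w n * b n j) * (a j * \<bar>f j\<bar>) \<le> \<kappa> * w j * (a j * \<bar>f j\<bar>)"
      using sum_frag_le[OF that] a_nonneg[OF that] by (intro mult_right_mono) auto
    then show ?thesis by (simp add: Aabs[OF that] sum_distrib_right mult.assoc)
  qed
  have sx: "(\<lambda>j. ?x n j) summable_on {1..}" if n: "n \<ge> 1" for n
  proof (rule summable_on_comparison_test[OF sA])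
    fix j :: nat assume j: "j \<in> {1..}"
    then have "?x n j \<le> (\<Sum>m=1..n. ?x m j)"
      by (intro member_le_sum) (use n x0 in auto)
    with sum_x[of j n] j show "?x n j \<le> \<kappa> * (w j * \<bar>Aop a f j\<bar>)" by simp
  qed (use x0 n in auto)
  have B: "w n * \<bar>Bop a b f n\<bar> \<le> (\<Sum>\<^sub>\<infinity>j\<in>{1..}. ?x n j)" if n: "n \<ge> 1" for n
  proof -
    have abs: "\<bar>w n * (a j * b n j * f j)\<bar> = ?x n j" if "j \<in> {1..}" for j
      using that n a_nonneg[of j] b_nonneg[of n j] w.weight_pos[of n] by (simp add: abs_mult)
    have "w n * Bop a b f n = (\<Sum>\<^sub>\<infinity>j\<in>{n<..}. w n * (a j * b n j * f j))"
      by (simp add: Bop_def infsum_cmult_right')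
    also have "\<dots> = (\<Sum>\<^sub>\<infinity>j\<in>{1..}. w n * (a j * b n j * f j))"
      by (rule infsum_cong_neutral) (use n b_zero in auto)
    also have "\<bar>\<dots>\<bar> \<le> (\<Sum>\<^sub>\<infinity>j\<in>{1..}. \<bar>w n * (a j * b n j * f j)\<bar>)"
    proof -
      have "(\<lambda>j. \<bar>w n * (a j * b n j * f j)\<bar>) summable_on {1..}"
        by (subst summable_on_cong[OF abs]) (use sx[OF n] in auto)
      then show ?thesis
        using norm_infsum_bound[of "\<lambda>j. w n * (a j * b n j * f j)" "{1..}"] by simp
    qed
    also have "\<dots> = (\<Sum>\<^sub>\<infinity>j\<in>{1..}. ?x n j)"
      by (rule infsum_cong[OF abs])
    finally show ?thesis using w.weight_pos[OF n] by (simp add: abs_mult)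
  qed
  have hs: "((\<lambda>j. \<Sum>n=1..N. ?x n j) has_sum (\<Sum>n=1..N. \<Sum>\<^sub>\<infinity>j\<in>{1..}. ?x n j)) {1..}"
  proof (induction N)
    case (Suc N)
    show ?case
      using has_sum_add[OF Suc has_sum_infsum[OF sx[of "Suc N"]]] by simp
  qed simp
  have "(\<Sum>n=1..N. w n * \<bar>Bop a b f n\<bar>) \<le> (\<Sum>n=1..N. \<Sum>\<^sub>\<infinity>j\<in>{1..}. ?x n j)"
    by (rule sum_mono) (use B in auto)
  also have "\<dots> \<le> (\<Sum>\<^sub>\<infinity>j\<in>{1..}. \<kappa> * (w j * \<bar>Aop a f j\<bar>))"
    by (rule has_sum_mono[OF hs has_sum_infsum[OF sA]]) (use sum_x in auto)
  also have "\<dots> = \<kappa> * nrm w (Aop a f)"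
    by (simp add: infsum_cmult_right' nrm_def)
  finally show "(\<Sum>n=1..N. w n * \<bar>Bop a b f n\<bar>) \<le> \<kappa> * nrm w (Aop a f)" .
qed

lemma DG_D:
  assumes "f \<in> DG w a b"
  shows "l1 w f" "l1 w (Aop a f)" "l1 w (Bop a b f)" "l1 w (Gop a b f)"
    "w.emb (Gop a b f) = w.emb (Aop a f) + w.emb (Bop a b f)"
  using assms w.l1_add w.emb_add unfolding DG_def DA_def DB_def Gop_def by auto

lemma Gop_bounds:
  assumes f: "f \<in> DG w a b"
  shows "(1 - \<kappa>) * nrm w (Aop a f) \<le> norm (w.emb (Gop a b f))"
    "norm (w.emb (Gop a b f)) \<le> (1 + \<kappa>) * nrm w (Aop a f)"
proof -
  note D = DG_D[OF f]
  have B: "norm (w.emb (Bop a b f)) \<le> \<kappa> * norm (w.emb (Aop a f))"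
    using nrm_Bop_le[OF D(2)] by (simp add: w.norm_emb D)
  show "(1 - \<kappa>) * nrm w (Aop a f) \<le> norm (w.emb (Gop a b f))"
    using norm_diff_ineq[of "w.emb (Aop a f)" "w.emb (Bop a b f)"] B
    by (simp add: D(5) left_diff_distrib w.norm_emb[OF D(2)])
  show "norm (w.emb (Gop a b f)) \<le> (1 + \<kappa>) * nrm w (Aop a f)"
    using norm_triangle_ineq[of "w.emb (Aop a f)" "w.emb (Bop a b f)"] B
    by (simp add: D(5) distrib_right w.norm_emb[OF D(2)])
qed

text \<open>The loss operator is diagonal and nonpositive, so for it alone the estimate is an
  equality with gain \<open>h * nrm w (Aop a f)\<close>; the fragmentation part takes back at most
  the fraction \<open>\<kappa>\<close> of that gain.\<close>

lemma Gop_dissipative: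
  assumes f: "f \<in> DG w a b" and h: "h > 0"
  shows "nrm w f + h * (1 - \<kappa>) * nrm w (Aop a f) \<le> norm (w.emb f - h *\<^sub>R w.emb (Gop a b f))"
proof -
  note D = DG_D[OF f]
  have "\<bar>coord (w.emb f - h *\<^sub>R w.emb (Aop a f)) n\<bar> = \<bar>coord (w.emb f) n\<bar> + h * \<bar>coord (w.emb (Aop a f)) n\<bar>" for n
  proof -
    let ?y = "w (Suc n) * f (Suc n)"
    have c: "coord (w.emb (Aop a f)) n = - a (Suc n) * ?y" "coord (w.emb f) n = ?y"
      unfolding w.coord_emb[OF D(1)] w.coord_emb[OF D(2)] by (simp_all add: Aop_def)
    then have "coord (w.emb f - h *\<^sub>R w.emb (Aop a f)) n = (1 + h * a (Suc n)) * ?y"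
      by (simp add: algebra_simps)
    also have "\<bar>\<dots>\<bar> = \<bar>?y\<bar> + h * \<bar>- a (Suc n) * ?y\<bar>"
      unfolding abs_mult[of "1 + h * a (Suc n)"] abs_mult[of "- a (Suc n)"]
      using a_nonneg[of "Suc n"] h by (simp add: distrib_right)
    finally show ?thesis unfolding c .
  qed
  then have n1: "norm (w.emb f - h *\<^sub>R w.emb (Aop a f)) = nrm w f + h * nrm w (Aop a f)"
    unfolding w.norm_emb[OF D(1), symmetric] w.norm_emb[OF D(2), symmetric] norm_ell1_def
    by (simp add: infsum_add coord_abs_summable summable_on_cmult_right infsum_cmult_right')
  have eq: "w.emb f - h *\<^sub>R w.emb (Aop a f) = (w.emb f - h *\<^sub>R w.emb (Gop a b f)) + h *\<^sub>R w.emb (Bop a b f)"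
    by (simp add: D(5) algebra_simps)
  have n2: "norm (w.emb f - h *\<^sub>R w.emb (Aop a f))
      \<le> norm (w.emb f - h *\<^sub>R w.emb (Gop a b f)) + norm (h *\<^sub>R w.emb (Bop a b f))"
    unfolding eq by (rule norm_triangle_ineq)
  have "norm (h *\<^sub>R w.emb (Bop a b f)) \<le> h * (\<kappa> * nrm w (Aop a f))"
    using nrm_Bop_le[OF D(2)] w.norm_emb[OF D(3)] h by simp
  with n1 n2 show ?thesis by (simp add: algebra_simps)
qed

end

locale fragmentation_semigroup = fragmentation +
  fixes S :: "real \<Rightarrow> (nat \<Rightarrow> real) \<Rightarrow> nat \<Rightarrow> real"
  assumes S_gen: "C0_semigroup_generated_by w S (Gop a b) (DG w a b)"
begin

definition T :: "real \<Rightarrow> nat ell1 \<Rightarrow> nat ell1" where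
  "T t x = w.emb (S t (w.proj x))"

lemma
  shows l1_S_all: "\<forall>t\<ge>0. \<forall>f. l1 w f \<longrightarrow> l1 w (S t f)"
    and S_lincomb_all: "\<forall>t\<ge>0. \<forall>f g c. l1 w f \<longrightarrow> l1 w g \<longrightarrow>
      eqv (S t (\<lambda>n. c * f n + g n)) (\<lambda>n. c * S t f n + S t g n)"
    and S_bounded_all: "\<forall>t\<ge>0. \<exists>M. \<forall>f. l1 w f \<longrightarrow> nrm w (S t f) \<le> M * nrm w f"
    and S_zero_all: "\<forall>f. l1 w f \<longrightarrow> eqv (S 0 f) f"
    and S_compose_all: "\<forall>t\<ge>0. \<forall>s\<ge>0. \<forall>f. l1 w f \<longrightarrow> eqv (S (t + s) f) (S t (S s f))"
    and S_ncont_all: "\<forall>f. l1 w f \<longrightarrow> ncont w {0..} (\<lambda>t. S t f)"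
    and S_domain_all: "\<forall>f. l1 w f \<longrightarrow> (f \<in> DG w a b \<longleftrightarrow> (\<exists>g. l1 w g \<and>
      ((\<lambda>h. nrm w (\<lambda>n. (S h f n - f n) / h - g n)) \<longlongrightarrow> 0) (at_right 0)))"
    and S_generator_all: "\<forall>f\<in>DG w a b. l1 w (Gop a b f) \<and>
      ((\<lambda>h. nrm w (\<lambda>n. (S h f n - f n) / h - Gop a b f n)) \<longlongrightarrow> 0) (at_right 0)"
  by (insert S_gen, unfold C0_semigroup_generated_by_def, (elim conjE, assumption)+)

lemmas l1_S = l1_S_all[rule_format]
  and S_bounded = S_bounded_all[rule_format]
  and S_zero = S_zero_all[rule_format]
  and S_compose = S_compose_all[rule_format]
  and S_ncont = S_ncont_all[rule_format]

lemma emb_S_lincomb: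
  assumes "l1 w f" "l1 w g" "t \<ge> 0"
  shows "w.emb (S t (\<lambda>n. c * f n + g n)) = c *\<^sub>R w.emb (S t f) + w.emb (S t g)"
  using w.emb_cong[OF S_lincomb_all[rule_format, OF assms(3,1,2), of c]]
  by (simp add: w.emb_lincomb l1_S assms)

text \<open>That \<open>S\<close> ignores the entry at 0 of its argument is derived: the difference
  of \<open>f\<close> and \<open>g\<close> has norm 0, and \<open>S t\<close> is linear and bounded.
  This frees \<open>T\<close> from the choice of representative in \<open>proj\<close>.\<close>

lemma emb_S_cong:
  assumes "l1 w f" "l1 w g" "w.emb f = w.emb g" "t \<ge> 0"
  shows "w.emb (S t f) = w.emb (S t g)"
proof -
  let ?h = "\<lambda>n. - 1 * f n + g n"
  have h: "l1 w ?h" "nrm w ?h = 0"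
    using w.l1_lincomb[OF assms(1,2), of "-1"] w.emb_lincomb[OF assms(1,2), of "-1"] assms(3)
    by (simp_all flip: w.norm_emb)
  then have "nrm w (S t ?h) \<le> 0"
    using S_bounded[OF assms(4)] by (metis mult_zero_right)
  then have "norm (w.emb (S t ?h)) \<le> 0"
    using w.norm_emb[OF l1_S[OF assms(4) h(1)]] by simp
  then show ?thesis using emb_S_lincomb[OF assms(1,2,4), of "-1"] by simp
qed

lemma T_emb: "l1 w f \<Longrightarrow> t \<ge> 0 \<Longrightarrow> T t (w.emb f) = w.emb (S t f)"
  unfolding T_def by (rule emb_S_cong) (auto simp: w.l1_proj)

sublocale C0_semigroup T
proof (rule C0_semigroup.intro)
  fix t s :: real and x :: "nat ell1"
  have x: "x = w.emb (w.proj x)" "l1 w (w.proj x)" by (simp_all add: w.l1_proj)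
  show "T 0 x = x"
    using T_emb[OF x(2), of 0] w.emb_cong[OF S_zero[OF x(2)]] by simp
  show "T (t + s) x = T t (T s x)" if "t \<ge> 0" "s \<ge> 0"
    using T_emb[OF x(2) that(2)] T_emb[OF l1_S[OF that(2) x(2)] that(1)] T_emb[OF x(2), of "t + s"]
      w.emb_cong[OF S_compose[OF that x(2)]] that by simp
  show "continuous_on {0..} (\<lambda>t. T t x)"
    using S_ncont[OF x(2)] unfolding w.ncont_iff T_def by simp
  show "bounded_linear (T t)" if t: "t \<ge> 0"
  proof -
    have lin: "T t (c *\<^sub>R x + y) = c *\<^sub>R T t x + T t y" for c x y
      using T_emb[OF w.l1_lincomb[OF w.l1_proj w.l1_proj] t, of c x y]
        emb_S_lincomb[OF w.l1_proj w.l1_proj t, of c x y] w.emb_lincomb[OF w.l1_proj w.l1_proj, of c x y]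
      by (simp add: T_def)
    have T0: "T t 0 = 0" using lin[of "-1" 0 0] by simp
    obtain M where M: "\<And>f. l1 w f \<Longrightarrow> nrm w (S t f) \<le> M * nrm w f"
      using S_bounded[OF t] by blast
    show ?thesis
    proof (rule bounded_linear_intro)
      show "T t (x + y) = T t x + T t y" for x y using lin[of 1 x y] by simp
      show "T t (c *\<^sub>R x) = c *\<^sub>R T t x" for c x using lin[of c x 0] T0 by simp
      show "norm (T t x) \<le> norm x * M" for x
        using M[OF w.l1_proj[of x]] w.norm_emb[OF w.l1_proj[of x]]
          w.norm_emb[OF l1_S[OF t w.l1_proj[of x]]]
        by (simp add: T_def mult.commute)
    qed
  qed
qed

lemma gen_emb_iff_tendsto:
  assumes f: "l1 w f" and g: "l1 w g"
  shows "gen (w.emb f) (w.emb g) \<longleftrightarrow>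
    ((\<lambda>h. nrm w (\<lambda>n. (S h f n - f n) / h - g n)) \<longlongrightarrow> 0) (at_right 0)"
proof -
  have l: "\<forall>\<^sub>F h in at_right 0. l1 w (\<lambda>n. (S h f n - f n) / h)"
    using eventually_at_right_0 by eventually_elim (intro w.l1_divide w.l1_diff l1_S f less_imp_le)
  have "\<forall>\<^sub>F h in at_right 0. w.emb (\<lambda>n. (S h f n - f n) / h) = (T h (w.emb f) - w.emb f) /\<^sub>R h"
    using eventually_at_right_0
  proof eventually_elim
    case (elim h)
    then have h: "h \<ge> 0" by simp
    show ?case
      unfolding T_emb[OF f h] w.emb_divide[OF w.l1_diff[OF l1_S[OF h f] f]] w.emb_diff[OF l1_S[OF h f] f] ..
  qed
  from tendsto_cong[OF this] show ?thesis
    unfolding w.tendsto_emb_iff[OF l g] gen_def by simp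
qed

text \<open>The way back from the abstract theory: a limit found there yields membership in the
  concrete maximal domain and identifies the value as \<open>Gop\<close>.\<close>

lemma gen_emb_iff:
  assumes f: "l1 w f"
  shows "gen (w.emb f) y \<longleftrightarrow> f \<in> DG w a b \<and> y = w.emb (Gop a b f)"
proof -
  have DG: "gen (w.emb f) (w.emb (Gop a b f))" if "f \<in> DG w a b"
  proof -
    have "((\<lambda>h. nrm w (\<lambda>n. (S h f n - f n) / h - Gop a b f n)) \<longlongrightarrow> 0) (at_right 0)"
      using S_generator_all that by blast
    then show ?thesis using gen_emb_iff_tendsto[OF f DG_D(4)[OF that]] by blast
  qed
  moreover have "f \<in> DG w a b" if "gen (w.emb f) y"
  proof -
    have "((\<lambda>h. nrm w (\<lambda>n. (S h f n - f n) / h - w.proj y n)) \<longlongrightarrow> 0) (at_right 0)"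
      using that gen_emb_iff_tendsto[OF f w.l1_proj, of y] by simp
    then show ?thesis
      using S_domain_all[rule_format, OF f] w.l1_proj[of y] by blast
  qed
  ultimately show ?thesis using gen_unique by blast
qed

lemma genD:
  assumes "gen x y"
  shows "w.proj x \<in> DG w a b" "x = w.emb (w.proj x)" "y = w.emb (Gop a b (w.proj x))"
  using gen_emb_iff[OF w.l1_proj, of x y] assms by auto

text \<open>The surplus found so far is \<open>(1 - \<kappa>)\<close> times the norm of
  \<open>Aop a f\<close>; \<open>norm y\<close> is at most \<open>(1 + \<kappa>)\<close> times that
  norm, which gives the quotient.\<close>

sublocale dissipative_semigroup T "(1 - \<kappa>) / (1 + \<kappa>)"
proof
  show "0 < (1 - \<kappa>) / (1 + \<kappa>)" using kappa by simp
  fix x y and h :: real assume xy: "gen x y" and h: "h > 0"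
  note g = genD[OF xy]
  define f where "f = w.proj x"
  have f: "f \<in> DG w a b" "x = w.emb f" "y = w.emb (Gop a b f)" using g by (auto simp: f_def)
  have "h * ((1 - \<kappa>) / (1 + \<kappa>)) * norm y = h * (1 - \<kappa>) * (norm y / (1 + \<kappa>))" by simp
  also have "\<dots> \<le> h * (1 - \<kappa>) * nrm w (Aop a f)"
    using Gop_bounds(2)[OF f(1)] h kappa f(3)
    by (intro mult_left_mono) (auto simp: pos_divide_le_eq mult.commute)
  finally show "norm x + h * ((1 - \<kappa>) / (1 + \<kappa>)) * norm y \<le> norm (x - h *\<^sub>R y)"
    using Gop_dissipative[OF f(1) h] w.norm_emb[OF DG_D(1)[OF f(1)]] f by simp
qed

end

section \<open>Regularity of mild solutions\<close>

text \<open>The scalar core of the interpolation: below the threshold \<open>r\<close> the first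
  term suffices, above it \<open>(1 + A) powr (\<alpha> - 1)\<close> is at most
  \<open>r powr (\<alpha> - 1)\<close> because the exponent is negative.\<close>

lemma one_plus_powr_le:
  fixes A r \<alpha> :: real
  assumes A: "A \<ge> 0" and r: "r \<ge> 1" and \<alpha>: "0 < \<alpha>" "\<alpha> < 1"
  shows "(1 + A) powr \<alpha> \<le> 2 * r powr \<alpha> + r powr (\<alpha> - 1) * A"
proof (cases "1 + A \<le> r")
  case True
  then have "(1 + A) powr \<alpha> \<le> r powr \<alpha>" using A \<alpha> by (intro powr_mono2) auto
  moreover have "0 \<le> r powr \<alpha>" "0 \<le> r powr (\<alpha> - 1) * A" using A by auto
  ultimately show ?thesis by linarith
next
  case False
  have "(1 + A) powr \<alpha> = (1 + A) powr (\<alpha> - 1) * (1 + A)"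
    using A by (simp add: powr_diff)
  also have "\<dots> \<le> r powr (\<alpha> - 1) * (1 + A)"
    using False A r \<alpha> by (intro mult_right_mono powr_mono2') auto
  also have "\<dots> \<le> r powr \<alpha> + r powr (\<alpha> - 1) * A"
    using powr_mono[of "\<alpha> - 1" \<alpha> r] r by (simp add: distrib_left)
  also have "\<dots> \<le> 2 * r powr \<alpha> + r powr (\<alpha> - 1) * A" by simp
  finally show ?thesis .
qed

locale coagulation_fragmentation =
  fragmentation_semigroup w a b \<kappa> S + coagulation_weights w wt
  for w a :: "nat \<Rightarrow> real" and b \<kappa> S and wt :: "nat \<Rightarrow> real" +
  fixes \<alpha> :: real
  assumes alpha: "0 < \<alpha>" "\<alpha> < 1"
    and wt_eq: "n \<ge> 1 \<Longrightarrow> wt n = (1 + a n) powr \<alpha> * w n"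
begin

lemma w_le_wt: "n \<ge> 1 \<Longrightarrow> w n \<le> wt n"
  using ge_one_powr_ge_zero[of "1 + a n" \<alpha>] a_nonneg[of n] w.weight_pos[of n] alpha
  by (simp add: wt_eq)

lemma l1_wt_imp_w:
  assumes "l1 wt f"
  shows "l1 w f" "nrm w f \<le> nrm wt f"
proof -
  have "(\<Sum>n=1..N. w n * \<bar>f n\<bar>) \<le> nrm wt f" for N
  proof -
    have "(\<Sum>n=1..N. w n * \<bar>f n\<bar>) \<le> (\<Sum>n=1..N. wt n * \<bar>f n\<bar>)"
      by (intro sum_mono mult_right_mono) (auto simp: w_le_wt)
    also have "\<dots> \<le> nrm wt f" by (rule wt.sum_le_nrm[OF assms])
    finally show ?thesis .
  qed
  from w.l1_leI[OF this] show "l1 w f" "nrm w f \<le> nrm wt f" .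
qed

text \<open>Multiplication by \<open>(1 + a) powr \<alpha>\<close> is unbounded; its truncations are bounded, and a bound
  uniform in \<open>N\<close> is a bound for the \<open>wt\<close>-norm.\<close>

definition trunc :: "nat \<Rightarrow> nat ell1 \<Rightarrow> nat ell1" where
  "trunc N x = Abs_ell1 (\<lambda>i. if i < N then (1 + a (Suc i)) powr \<alpha> * coord x i else 0)"

lemma sum_trunc_le:
  fixes g :: "nat \<Rightarrow> real"
  assumes "finite F"
  shows "(\<Sum>i\<in>F. \<bar>if i < N then g i else 0\<bar>) \<le> (\<Sum>i<N. \<bar>g i\<bar>)"
proof -
  have "(\<Sum>i\<in>F. \<bar>if i < N then g i else 0\<bar>) = (\<Sum>i\<in>F \<inter> {..<N}. \<bar>g i\<bar>)"
    by (rule sum.mono_neutral_cong_right) (use assms in auto)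
  also have "\<dots> \<le> (\<Sum>i<N. \<bar>g i\<bar>)" by (rule sum_mono2) auto
  finally show ?thesis .
qed

lemma coord_trunc: "coord (trunc N x) i = (if i < N then (1 + a (Suc i)) powr \<alpha> * coord x i else 0)"
proof -
  have "(\<lambda>i. \<bar>if i < N then (1 + a (Suc i)) powr \<alpha> * coord x i else 0\<bar>) summable_on UNIV"
    by (rule summable_on_UNIV_if_sums_le[OF sum_trunc_le])
  then show ?thesis by (simp add: trunc_def Abs_ell1_inverse)
qed

lemma norm_trunc: "norm (trunc N x) = (\<Sum>i<N. (1 + a (Suc i)) powr \<alpha> * \<bar>coord x i\<bar>)"
proof (rule antisym)
  have eq: "\<bar>(1 + a (Suc i)) powr \<alpha> * coord x i\<bar> = (1 + a (Suc i)) powr \<alpha> * \<bar>coord x i\<bar>" for i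
    by (simp add: abs_mult)
  show "norm (trunc N x) \<le> (\<Sum>i<N. (1 + a (Suc i)) powr \<alpha> * \<bar>coord x i\<bar>)"
    unfolding eq[symmetric] by (rule norm_ell1_leI) (simp only: coord_trunc sum_trunc_le)
  have "(\<Sum>i<N. (1 + a (Suc i)) powr \<alpha> * \<bar>coord x i\<bar>) = (\<Sum>i<N. \<bar>coord (trunc N x) i\<bar>)"
    by (rule sum.cong) (auto simp: coord_trunc eq)
  also have "\<dots> \<le> norm (trunc N x)" by (rule sum_abs_coord_le_norm) simp
  finally show "(\<Sum>i<N. (1 + a (Suc i)) powr \<alpha> * \<bar>coord x i\<bar>) \<le> norm (trunc N x)" .
qed

lemma bounded_linear_trunc: "bounded_linear (trunc N)"
proof (rule bounded_linear_intro)
  show "trunc N (x + y) = trunc N x + trunc N y" for x y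
    by (rule ell1_eqI) (simp add: coord_trunc distrib_left)
  show "trunc N (c *\<^sub>R x) = c *\<^sub>R trunc N x" for c x
    by (rule ell1_eqI) (simp add: coord_trunc)
  show "norm (trunc N x) \<le> norm x * (\<Sum>i<N. (1 + a (Suc i)) powr \<alpha>)" for x
    unfolding norm_trunc sum_distrib_left
    by (rule sum_mono) (simp add: mult.commute mult_right_mono abs_coord_le_norm)
qed

text \<open>The scalar inequality is used in every coordinate with \<open>A = a (Suc i)\<close>, and
  \<open>(1 - \<kappa>)\<close> times the norm of \<open>Aop a f\<close> is at most
  \<open>norm y\<close>, because the fragmentation part cannot cancel the loss. The constant is free
  of \<open>N\<close>.\<close>

lemma interpolating_trunc: "interpolating (trunc N) (2 / (1 - \<kappa>)) \<alpha>"
  unfolding interpolating_def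
proof (intro conjI allI impI bounded_linear_trunc)
  fix x y and r :: real assume xy: "gen x y" and r: "r \<ge> 1"
  define f where "f = w.proj x"
  have f: "f \<in> DG w a b" "x = w.emb f" "y = w.emb (Gop a b f)"
    using genD[OF xy] by (auto simp: f_def)
  let ?A = "w.emb (Aop a f)"
  have A: "a (Suc i) * \<bar>coord x i\<bar> = \<bar>coord ?A i\<bar>" for i
    using a_nonneg[of "Suc i"]
    unfolding f(2) w.coord_emb[OF DG_D(1)[OF f(1)]] w.coord_emb[OF DG_D(2)[OF f(1)]]
    by (simp add: Aop_def abs_mult)
  have "norm (trunc N x) \<le> (\<Sum>i<N. 2 * r powr \<alpha> * \<bar>coord x i\<bar> + r powr (\<alpha> - 1) * \<bar>coord ?A i\<bar>)"
    unfolding norm_trunc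
  proof (rule sum_mono)
    fix i
    have "(1 + a (Suc i)) powr \<alpha> * \<bar>coord x i\<bar> \<le> (2 * r powr \<alpha> + r powr (\<alpha> - 1) * a (Suc i)) * \<bar>coord x i\<bar>"
      by (rule mult_right_mono[OF one_plus_powr_le]) (use a_nonneg r alpha in auto)
    then show "(1 + a (Suc i)) powr \<alpha> * \<bar>coord x i\<bar>
        \<le> 2 * r powr \<alpha> * \<bar>coord x i\<bar> + r powr (\<alpha> - 1) * \<bar>coord ?A i\<bar>"
      by (simp only: distrib_right mult.assoc A)
  qed
  also have "\<dots> = 2 * r powr \<alpha> * (\<Sum>i<N. \<bar>coord x i\<bar>) + r powr (\<alpha> - 1) * (\<Sum>i<N. \<bar>coord ?A i\<bar>)"
    by (simp only: sum.distrib sum_distrib_left)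
  also have "\<dots> \<le> 2 * r powr \<alpha> * norm x + r powr (\<alpha> - 1) * norm ?A"
    by (intro add_mono mult_left_mono sum_abs_coord_le_norm) auto
  also have "\<dots> \<le> 2 / (1 - \<kappa>) * (r powr \<alpha> * norm x) + 2 / (1 - \<kappa>) * (r powr (\<alpha> - 1) * norm y)"
  proof (rule add_mono)
    have "2 * (r powr \<alpha> * norm x) \<le> 2 / (1 - \<kappa>) * (r powr \<alpha> * norm x)"
      using kappa by (intro mult_right_mono) (auto simp: field_simps)
    then show "2 * r powr \<alpha> * norm x \<le> 2 / (1 - \<kappa>) * (r powr \<alpha> * norm x)" by simp
    have "(1 - \<kappa>) * norm ?A \<le> norm y"
      using Gop_bounds(1)[OF f(1)] w.norm_emb[OF DG_D(2)[OF f(1)]] f(3) by simp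
    then have "norm ?A \<le> 1 / (1 - \<kappa>) * norm y"
      using kappa by (simp add: pos_le_divide_eq mult.commute)
    also have "\<dots> \<le> 2 / (1 - \<kappa>) * norm y"
      using kappa by (intro mult_right_mono divide_right_mono) auto
    finally have "r powr (\<alpha> - 1) * norm ?A \<le> r powr (\<alpha> - 1) * (2 / (1 - \<kappa>) * norm y)"
      by (intro mult_left_mono) auto
    then show "r powr (\<alpha> - 1) * norm ?A \<le> 2 / (1 - \<kappa>) * (r powr (\<alpha> - 1) * norm y)"
      by (simp only: mult.left_commute)
  qed
  finally show "norm (trunc N x) \<le> 2 / (1 - \<kappa>) * (r powr \<alpha> * norm x + r powr (\<alpha> - 1) * norm y)"
    by (simp only: distrib_left)
qed

lemma nrm_wt_leI:
  assumes f: "l1 w f" and le: "\<And>N. norm (trunc N (w.emb f)) \<le> C"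
  shows "nrm wt f \<le> C"
proof (rule wt.l1_leI(2))
  fix N
  have "wt (Suc i) * \<bar>f (Suc i)\<bar> = (1 + a (Suc i)) powr \<alpha> * \<bar>coord (w.emb f) i\<bar>" for i
    unfolding w.coord_emb[OF f] using w.weight_pos[of "Suc i"] by (simp add: wt_eq abs_mult)
  then have "(\<Sum>n=1..N. wt n * \<bar>f n\<bar>) = norm (trunc N (w.emb f))"
    by (simp add: norm_trunc sum.atLeast1_atMost_eq)
  with le show "(\<Sum>n=1..N. wt n * \<bar>f n\<bar>) \<le> C" by simp
qed

text \<open>Working on a compact interval makes all kernel constants uniform. One \<open>e\<close>
  is spent on the Hoelder continuity of \<open>u\<close> in the \<open>wt\<close>-norm, the second
  on entering the domain.\<close>

lemma mild_imp_regular: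
  fixes u :: "real \<Rightarrow> nat \<Rightarrow> real" and k :: "nat \<Rightarrow> nat \<Rightarrow> real \<Rightarrow> real"
  assumes \<tau>: "\<tau> > 0" and u: "ncont wt {0..\<tau>} u" and u0: "l1 w u0"
    and k: "\<And>t. t \<in> {0..\<tau>} \<Longrightarrow> dominated (\<lambda>n j. k n j t) c"
    and kd: "\<And>s t. s \<in> {0..\<tau>} \<Longrightarrow> t \<in> {0..\<tau>} \<Longrightarrow>
      dominated (\<lambda>n j. k n j t - k n j s) (c' * \<bar>t - s\<bar> powr \<theta>)"
    and \<theta>: "\<theta> > 0" and c': "c' \<ge> 0"
    and mild: "\<And>t n. t \<in> {0..\<tau>} \<Longrightarrow> n \<ge> 1 \<Longrightarrow>
      u t n = S t u0 n + integral {0..t} (\<lambda>s. S (t - s) (Kop k s (u s)) n)"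
    and e: "e > 0"
  defines "u' \<equiv> \<lambda>t n. Gop a b (u t) n + Kop k t (u t) n"
  shows "\<And>t. t \<in> {2 * e..\<tau>} \<Longrightarrow> u t \<in> DG w a b"
    and "ncont w {2 * e..\<tau>} u'"
    and "\<And>t. t \<in> {2 * e..\<tau>} \<Longrightarrow>
      ((\<lambda>s. (w.emb (u s) - w.emb (u t)) /\<^sub>R (s - t)) \<longlongrightarrow> w.emb (u' t)) (at t within {2 * e..\<tau>})"
proof -
  have ul: "l1 wt (u t)" if "t \<in> {0..\<tau>}" for t using u that by (simp add: wt.ncont_iff)
  have uc: "continuous_on {0..\<tau>} (\<lambda>t. wt.emb (u t))" using u by (simp add: wt.ncont_iff)
  have ulw: "l1 w (u t)" if "t \<in> {0..\<tau>}" for t using l1_wt_imp_w(1)[OF ul[OF that]] .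
  have "bounded ((\<lambda>t. wt.emb (u t)) ` {0..\<tau>})"
    by (rule compact_imp_bounded[OF compact_continuous_image[OF uc compact_Icc]])
  then obtain R where "\<forall>x\<in>(\<lambda>t. wt.emb (u t)) ` {0..\<tau>}. norm x \<le> R"
    unfolding bounded_iff by blast
  then have R: "nrm wt (u t) \<le> R" if "t \<in> {0..\<tau>}" for t
    unfolding wt.norm_emb[OF ul[OF that], symmetric] using that by blast
  have c: "c \<ge> 0" using k[of 0] \<tau> by (simp add: dominated_def)
  have R0: "R \<ge> 0" using R[of 0] wt.nrm_nonneg[of "u 0"] \<tau> by simp
  define U where "U t = w.emb (u t)" for t
  define g where "g t = w.emb (Kop k t (u t))" for t
  have gl: "l1 w (Kop k t (u t))" if "t \<in> {0..\<tau>}" for t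
    unfolding Kop_eq_Qop by (rule Qop_bound(1)[OF k ul ul]; rule that)
  have ud: "nrm wt (\<lambda>n. u t n - u s n) = norm (wt.emb (u t) - wt.emb (u s))"
    if "s \<in> {0..\<tau>}" "t \<in> {0..\<tau>}" for s t
    using that ul by (simp add: wt.norm_emb wt.l1_diff flip: wt.emb_diff)
  have Ud: "norm (U t - U s) \<le> norm (wt.emb (u t) - wt.emb (u s))" if st: "s \<in> {0..\<tau>}" "t \<in> {0..\<tau>}" for s t
    using l1_wt_imp_w[OF wt.l1_diff[OF ul[OF st(2)] ul[OF st(1)]]] ud[OF st] ulw[OF st(1)] ulw[OF st(2)]
    by (simp add: U_def w.norm_emb flip: w.emb_diff)
  have gd: "norm (g t - g s) \<le> 3 / 2 * (c' * \<bar>t - s\<bar> powr \<theta>) * R\<^sup>2 + 3 * c * R * nrm wt (\<lambda>n. u t n - u s n)"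
    if st: "s \<in> {0..\<tau>}" "t \<in> {0..\<tau>}" for s t
    unfolding g_def by (rule norm_Kop_diff_le[where c = c]) (use st k kd ul R in auto)
  have Uc: "continuous_on {0..\<tau>} U"
    unfolding continuous_on_def
  proof
    fix t assume t: "t \<in> {0..\<tau>}"
    have "((\<lambda>s. norm (wt.emb (u s) - wt.emb (u t))) \<longlongrightarrow> 0) (at t within {0..\<tau>})"
      using uc t unfolding continuous_on_def by (intro tendsto_norm_zero) (simp add: LIM_zero_iff)
    then have "((\<lambda>s. U s - U t) \<longlongrightarrow> 0) (at t within {0..\<tau>})"
      by (rule Lim_null_comparison[rotated])
        (use Ud t in \<open>auto simp: eventually_at_filter intro!: always_eventually\<close>)
    then show "(U \<longlongrightarrow> U t) (at t within {0..\<tau>})" by (simp add: LIM_zero_iff)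
  qed
  have gc: "continuous_on {0..\<tau>} g"
    unfolding continuous_on_def
  proof
    fix t assume t: "t \<in> {0..\<tau>}"
    have "((\<lambda>s. norm (wt.emb (u s) - wt.emb (u t))) \<longlongrightarrow> 0) (at t within {0..\<tau>})"
      using uc t unfolding continuous_on_def by (intro tendsto_norm_zero) (simp add: LIM_zero_iff)
    moreover have "((\<lambda>s. \<bar>s - t\<bar> powr \<theta>) \<longlongrightarrow> \<bar>t - t\<bar> powr \<theta>) (at t within {0..\<tau>})"
      using \<theta> by (intro tendsto_intros tendsto_powr') auto
    ultimately have "((\<lambda>s. 3 / 2 * (c' * \<bar>s - t\<bar> powr \<theta>) * R\<^sup>2 + 3 * c * R * norm (wt.emb (u s) - wt.emb (u t)))
        \<longlongrightarrow> 3 / 2 * (c' * \<bar>t - t\<bar> powr \<theta>) * R\<^sup>2 + 3 * c * R * 0) (at t within {0..\<tau>})"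
      by (intro tendsto_add tendsto_mult tendsto_const)
    then have lim: "((\<lambda>s. 3 / 2 * (c' * \<bar>s - t\<bar> powr \<theta>) * R\<^sup>2 + 3 * c * R * norm (wt.emb (u s) - wt.emb (u t)))
        \<longlongrightarrow> 0) (at t within {0..\<tau>})"
      by simp
    have "norm (g s - g t) \<le> 3 / 2 * (c' * \<bar>s - t\<bar> powr \<theta>) * R\<^sup>2 + 3 * c * R * norm (wt.emb (u s) - wt.emb (u t))"
      if "s \<in> {0..\<tau>}" for s
      using gd[OF t that] unfolding ud[OF t that] .
    then have "((\<lambda>s. g s - g t) \<longlongrightarrow> 0) (at t within {0..\<tau>})"
      by (intro Lim_null_comparison[OF _ lim]) (auto simp: eventually_at_filter intro!: always_eventually)
    then show "(g \<longlongrightarrow> g t) (at t within {0..\<tau>})" by (simp add: LIM_zero_iff)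
  qed
  have ev: "evolves \<tau> g U"
  proof (rule evolves_if_mild[OF gc, of _ "w.emb u0"])
    fix t assume t: "0 \<le> t" "t \<le> \<tau>"
    show "U t = T t (w.emb u0) + integral {0..t} (\<lambda>r. T (t - r) (g r))"
    proof (rule ell1_eqI)
      fix n
      \<comment> \<open>The mild formula is known for coordinates only. The integrand is continuous
        into \<open>nat ell1\<close>, so its vector-valued integral exists and coordinates commute
        with it.\<close>
      have int: "(\<lambda>r. T (t - r) (g r)) integrable_on {0..t}"
        by (intro integrable_continuous_interval continuous_on_Duhamel continuous_on_subset[OF gc]) (use t in auto)
      have "coord (integral {0..t} (\<lambda>r. T (t - r) (g r))) n = integral {0..t} (\<lambda>r. coord (T (t - r) (g r)) n)"
        using integral_linear[OF int bounded_linear_coord, of n] by (simp add: o_def)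
      also have "\<dots> = integral {0..t} (\<lambda>r. w (Suc n) * S (t - r) (Kop k r (u r)) (Suc n))"
      proof (rule integral_cong)
        fix r assume r: "r \<in> {0..t}"
        then have r': "r \<in> {0..\<tau>}" "0 \<le> t - r" using t by auto
        show "coord (T (t - r) (g r)) n = w (Suc n) * S (t - r) (Kop k r (u r)) (Suc n)"
          unfolding g_def T_emb[OF gl[OF r'(1)] r'(2)] w.coord_emb[OF l1_S[OF r'(2) gl[OF r'(1)]]] ..
      qed
      also have "\<dots> = w (Suc n) * integral {0..t} (\<lambda>r. S (t - r) (Kop k r (u r)) (Suc n))"
        by simp
      finally show "coord (U t) n = coord (T t (w.emb u0) + integral {0..t} (\<lambda>r. T (t - r) (g r))) n"
        using t mild[of t "Suc n"] ulw[of t] l1_S[OF t(1) u0]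
        by (simp add: U_def w.coord_emb T_emb[OF u0 t(1)] distrib_left)
    qed
  qed
  have "bounded (U ` {0..\<tau>})" "bounded (g ` {0..\<tau>})"
    using Uc gc by (auto intro!: compact_imp_bounded compact_continuous_image)
  then have "bounded (U ` {0..\<tau>} \<union> g ` {0..\<tau>})" by simp
  then obtain M where "\<forall>x\<in>U ` {0..\<tau>} \<union> g ` {0..\<tau>}. norm x \<le> M"
    unfolding bounded_iff by blast
  then have M: "\<And>t. t \<in> {0..\<tau>} \<Longrightarrow> norm (U t) \<le> M" "\<And>t. t \<in> {0..\<tau>} \<Longrightarrow> norm (g t) \<le> M"
    by blast+
  have M0: "M \<ge> 0" using M(1)[of 0] norm_ge_zero[of "U 0"] \<tau> by (simp del: norm_ge_zero)
  define \<delta> where "\<delta> = (1 - \<kappa>) / (1 + \<kappa>)"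
  define C where "C = 2 / (1 - \<kappa>) * (1 + 1 / \<delta>) * M * (4 / \<delta> + 3 / (1 - \<alpha>))"
  have C0: "C \<ge> 0" using kappa alpha M0 by (simp add: C_def \<delta>_def)
  \<comment> \<open>With \<open>d = sqrt (t - s)\<close>, the bound 1/4 ensures
    \<open>d \<le> 1 / 2\<close> and \<open>e\<^sup>2\<close> ensures \<open>d \<le> e\<close>, so
    that restarting at \<open>s - d\<close> stays at nonnegative times; \<open>e\<close> itself is
    what the look-back in the domain argument requires.\<close>
  define \<eta> where "\<eta> = min (1 / 4) (min e (e\<^sup>2))"
  have \<eta>: "0 < \<eta>" "\<eta> \<le> e" "\<eta> \<le> 1 / 4" "\<eta> \<le> e\<^sup>2" using e by (auto simp: \<eta>_def)
  have uH: "nrm wt (\<lambda>n. u t n - u s n) \<le> C * (t - s) powr ((1 - \<alpha>) / 2)"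
    if st: "e \<le> s" "s < t" "t \<le> \<tau>" "t - s \<le> \<eta>" for s t
  proof (rule nrm_wt_leI)
    have st': "s \<in> {0..\<tau>}" "t \<in> {0..\<tau>}" using st e by auto
    show "l1 w (\<lambda>n. u t n - u s n)" by (intro w.l1_diff ulw st')
    fix N
    define d where "d = sqrt (t - s)"
    have d2: "d\<^sup>2 = t - s" and d0: "d > 0" using st by (auto simp: d_def)
    have "d \<le> sqrt (1 / 4)" unfolding d_def using st \<eta> by (intro real_sqrt_le_mono) linarith
    then have dh: "d \<le> 1 / 2" by (simp add: real_sqrt_divide)
    have "d \<le> sqrt (e\<^sup>2)" unfolding d_def using st \<eta> by (intro real_sqrt_le_mono) linarith
    then have de: "d \<le> s" using e st by simp
    have "norm (trunc N (U (s + d\<^sup>2) - U s)) \<le> C * d powr (1 - \<alpha>)"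
      unfolding C_def \<delta>_def
      by (rule interpolating_Hoelder[OF interpolating_trunc _ alpha ev gc M d0 dh de])
        (use kappa st d2 in auto)
    also have "d powr (1 - \<alpha>) = (t - s) powr ((1 - \<alpha>) / 2)"
      using st by (simp add: d_def powr_half_sqrt[symmetric] powr_powr)
    finally show "norm (trunc N (w.emb (\<lambda>n. u t n - u s n))) \<le> C * (t - s) powr ((1 - \<alpha>) / 2)"
      unfolding d2 using ulw[OF st'(1)] ulw[OF st'(2)] by (simp add: U_def w.emb_diff)
  qed
  \<comment> \<open>Time increments are at most \<open>\<eta> < 1\<close>, so the smaller exponent
    gives the larger power and dominates both sources of error, the kernel and the solution.\<close>
  define \<gamma> where "\<gamma> = min \<theta> ((1 - \<alpha>) / 2)"
  have \<gamma>_le: "\<gamma> \<le> \<theta>" "\<gamma> \<le> (1 - \<alpha>) / 2"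
    unfolding \<gamma>_def by (rule min.cobounded1, rule min.cobounded2)
  have \<gamma>: "\<gamma> > 0" using \<theta> alpha by (simp add: \<gamma>_def)
  define H where "H = 3 / 2 * c' * R\<^sup>2 + 3 * c * R * C"
  have H: "H \<ge> 0" using c c' R0 C0 by (simp add: H_def)
  have gH: "norm (g t - g s) \<le> H * (t - s) powr \<gamma>"
    if st: "e \<le> s" "s \<le> t" "t \<le> \<tau>" "t - s \<le> \<eta>" for s t
  proof (cases "s = t")
    case False
    with st have lt: "s < t" by simp
    have st': "s \<in> {0..\<tau>}" "t \<in> {0..\<tau>}" using st e by auto
    have p: "(t - s) powr \<theta> \<le> (t - s) powr \<gamma>" "(t - s) powr ((1 - \<alpha>) / 2) \<le> (t - s) powr \<gamma>"
      using st lt \<eta> by (auto intro!: powr_mono' \<gamma>_le)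
    have "norm (g t - g s) \<le> 3 / 2 * (c' * \<bar>t - s\<bar> powr \<theta>) * R\<^sup>2 + 3 * c * R * nrm wt (\<lambda>n. u t n - u s n)"
      by (rule gd[OF st'])
    also have "\<dots> \<le> 3 / 2 * (c' * (t - s) powr \<gamma>) * R\<^sup>2 + 3 * c * R * (C * (t - s) powr \<gamma>)"
    proof (rule add_mono)
      show "3 / 2 * (c' * \<bar>t - s\<bar> powr \<theta>) * R\<^sup>2 \<le> 3 / 2 * (c' * (t - s) powr \<gamma>) * R\<^sup>2"
        using p(1) lt c' by (intro mult_right_mono mult_left_mono) auto
      have "nrm wt (\<lambda>n. u t n - u s n) \<le> C * (t - s) powr \<gamma>"
        using uH[OF st(1) lt st(3,4)] mult_left_mono[OF p(2) C0] by linarith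
      then show "3 * c * R * nrm wt (\<lambda>n. u t n - u s n) \<le> 3 * c * R * (C * (t - s) powr \<gamma>)"
        using c R0 by (intro mult_left_mono) auto
    qed
    finally show ?thesis by (simp add: H_def algebra_simps)
  qed simp
  obtain z where z: "continuous_on {2 * e..\<tau>} z" "\<And>t. t \<in> {2 * e..\<tau>} \<Longrightarrow> gen (U t) (z t)"
    using generator_domain_if_Hoelder[OF ev gc Uc \<eta>(1,2) \<gamma> H gH] by blast
  have sub: "t \<in> {0..\<tau>}" if "t \<in> {2 * e..\<tau>}" for t using that e by auto
  show DG: "u t \<in> DG w a b" if t: "t \<in> {2 * e..\<tau>}" for t
    using z(2)[OF t] gen_emb_iff[OF ulw[OF sub[OF t]]] by (simp add: U_def)
  have zt: "z t = w.emb (Gop a b (u t))" if t: "t \<in> {2 * e..\<tau>}" for t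
    using z(2)[OF t] gen_emb_iff[OF ulw[OF sub[OF t]]] by (simp add: U_def)
  have u': "l1 w (u' t)" "w.emb (u' t) = z t + g t" if t: "t \<in> {2 * e..\<tau>}" for t
    unfolding u'_def zt[OF t] g_def
    using w.l1_add[OF DG_D(4)[OF DG[OF t]] gl[OF sub[OF t]]] w.emb_add[OF DG_D(4)[OF DG[OF t]] gl[OF sub[OF t]]]
    by auto
  have "continuous_on {2 * e..\<tau>} (\<lambda>t. z t + g t)"
    by (intro continuous_intros z(1) continuous_on_subset[OF gc]) (use e in auto)
  then have "continuous_on {2 * e..\<tau>} (\<lambda>t. w.emb (u' t))"
    by (simp only: u'(2) cong: continuous_on_cong)
  then show "ncont w {2 * e..\<tau>} u'"
    unfolding w.ncont_iff using u'(1) by blast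
  show "((\<lambda>s. (w.emb (u s) - w.emb (u t)) /\<^sub>R (s - t)) \<longlongrightarrow> w.emb (u' t)) (at t within {2 * e..\<tau>})"
    if t: "t \<in> {2 * e..\<tau>}" for t
    using derivative_if_generator_domain[OF ev gc _ z t] e unfolding u'(2)[OF t] U_def by simp
qed

end

theorem theorem4p15:
  fixes T :: ereal and a :: "nat \<Rightarrow> real" and b :: "nat \<Rightarrow> nat \<Rightarrow> real"
    and k :: "nat \<Rightarrow> nat \<Rightarrow> real \<Rightarrow> real" and w wt :: "nat \<Rightarrow> real"
    and \<kappa> \<alpha> :: real
    and S :: "real \<Rightarrow> (nat \<Rightarrow> real) \<Rightarrow> nat \<Rightarrow> real"
    and u0 :: "nat \<Rightarrow> real" and tmax :: ereal and u :: "real \<Rightarrow> nat \<Rightarrow> real"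
  assumes T_pos: "0 < T"
    and a_nonneg: "\<forall>n\<ge>1. a n \<ge> 0"
    and b_nonneg: "\<forall>n\<ge>1. \<forall>j\<ge>1. b n j \<ge> 0"
    and b_zero: "\<forall>n\<ge>1. \<forall>j\<ge>1. j \<le> n \<longrightarrow> b n j = 0"
    and k_cont: "\<forall>n\<ge>1. \<forall>j\<ge>1. continuous_on (interval0 T) (k n j)"
    and k_nonneg: "\<forall>n\<ge>1. \<forall>j\<ge>1. \<forall>t\<in>interval0 T. k n j t \<ge> 0"
    and k_sym: "\<forall>n\<ge>1. \<forall>j\<ge>1. \<forall>t\<in>interval0 T. k n j t = k j n t"
    and w_ge: "\<forall>n\<ge>1. w n \<ge> real n"
    and w_mono: "\<forall>n\<ge>1. \<forall>m\<ge>n. w n \<le> w m"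
    and w_frag: "\<forall>j\<ge>2. (\<Sum>n=1..j-1. w n * b n j) \<le> \<kappa> * w j"
    and kappa: "0 < \<kappa>" "\<kappa> < 1"
    and alpha: "0 < \<alpha>" "\<alpha> < 1"
    and wt_def: "\<forall>n\<ge>1. wt n = (1 + a n) powr \<alpha> * w n"
    and k_bound: "\<forall>t'. 0 < t' \<and> ereal t' < T \<longrightarrow>
        (\<exists>c>0. \<forall>n\<ge>1. \<forall>j\<ge>1. \<forall>t\<in>{0..t'}. k n j t \<le> c * wt n * wt j / w (n + j))"
    and k_hoelder: "\<forall>t'. 0 < t' \<and> ereal t' < T \<longrightarrow>
        (\<exists>c>0. \<exists>\<theta>. 0 < \<theta> \<and> \<theta> < 1 \<and>
           (\<forall>n\<ge>1. \<forall>j\<ge>1. \<forall>s\<in>{0..t'}. \<forall>t\<in>{0..t'}.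
              \<bar>k n j t - k n j s\<bar> \<le> c * (wt n * wt j / w (n + j)) * \<bar>t - s\<bar> powr \<theta>))"
    and S_gen: "C0_semigroup_generated_by w S (Gop a b) (DG w a b)"
    and u0_l1: "l1 wt u0"
    and u0_nonneg: "\<forall>n\<ge>1. u0 n \<ge> 0"
    and u_mild: "mild_solution wt k T S u0 tmax u"
    and u_maximal: "\<forall>t2 v. mild_solution wt k T S u0 t2 v \<longrightarrow> t2 \<le> tmax"
  shows "classical_solution w wt a b k u0 tmax u"
proof -
  interpret coagulation_fragmentation w a b \<kappa> S wt \<alpha>
  proof
    show w_pos: "0 < w n" if "n \<ge> 1" for n
      using w_ge that by (smt (verit) of_nat_0_less_iff less_le_trans zero_less_one)
    show "0 < wt n" if "n \<ge> 1" for n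
      using w_pos[OF that] a_nonneg[rule_format, OF that] wt_def that by simp
  qed (use assms in auto)
  define u' where "u' t n = Gop a b (u t) n + Kop k t (u t) n" for t n
  have tm: "0 < tmax" "tmax \<le> T" and u: "ncont wt (interval0 tmax) u"
    and mild: "\<And>t n. t \<in> interval0 tmax \<Longrightarrow> n \<ge> 1 \<Longrightarrow>
      u t n = S t u0 n + integral {0..t} (\<lambda>s. S (t - s) (Kop k s (u s)) n)"
    using u_mild by (auto simp: mild_solution_def)
  have u0w: "l1 w u0" by (rule l1_wt_imp_w(1)[OF u0_l1])
  \<comment> \<open>The constants in the kernel hypotheses depend on the final time, so a time
    \<open>\<tau>\<close> strictly below \<open>tmax\<close> is fixed before they are
    chosen.\<close>
  have reg: "(\<forall>t\<in>{2 * e..\<tau>}. u t \<in> DG w a b) \<and> ncont w {2 * e..\<tau>} u' \<and> (\<forall>t\<in>{2 * e..\<tau>}.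
      ((\<lambda>s. (w.emb (u s) - w.emb (u t)) /\<^sub>R (s - t)) \<longlongrightarrow> w.emb (u' t)) (at t within {2 * e..\<tau>}))"
    if \<tau>: "0 < \<tau>" "ereal \<tau> < tmax" and e: "0 < e" for \<tau> e
  proof -
    have \<tau>T: "0 < \<tau> \<and> ereal \<tau> < T" using \<tau> tm(2) by auto
    have sub: "{0..\<tau>} \<subseteq> interval0 tmax"
      using \<tau>(2) by (auto simp: interval0_def intro: le_less_trans[of "ereal _" "ereal \<tau>"])
    have subT: "{0..\<tau>} \<subseteq> interval0 T"
      using sub tm(2) by (auto simp: interval0_def)
    obtain c where c: "c > 0"
      "\<And>n j t. n \<ge> 1 \<Longrightarrow> j \<ge> 1 \<Longrightarrow> t \<in> {0..\<tau>} \<Longrightarrow> k n j t \<le> c * wt n * wt j / w (n + j)"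
      using k_bound[rule_format, OF \<tau>T] by blast
    obtain c' \<theta> where c': "c' > 0" "0 < \<theta>"
      "\<And>n j s t. n \<ge> 1 \<Longrightarrow> j \<ge> 1 \<Longrightarrow> s \<in> {0..\<tau>} \<Longrightarrow> t \<in> {0..\<tau>} \<Longrightarrow>
        \<bar>k n j t - k n j s\<bar> \<le> c' * (wt n * wt j / w (n + j)) * \<bar>t - s\<bar> powr \<theta>"
      using k_hoelder[rule_format, OF \<tau>T] by blast
    have "dominated (\<lambda>n j. k n j t) c" if "t \<in> {0..\<tau>}" for t
      unfolding dominated_def
    proof (intro conjI allI impI)
      fix n j :: nat assume nj: "n \<ge> 1" "j \<ge> 1"
      then have "0 \<le> k n j t" using k_nonneg subT that by blast
      then show "\<bar>k n j t\<bar> \<le> c * (wt n * wt j / w (n + j))" using c(2)[OF nj that] by simp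
    qed (use c in simp)
    moreover have "dominated (\<lambda>n j. k n j t - k n j s) (c' * \<bar>t - s\<bar> powr \<theta>)"
      if "s \<in> {0..\<tau>}" "t \<in> {0..\<tau>}" for s t
      unfolding dominated_def using c'(1) c'(3)[OF _ _ that] by (simp add: mult_ac)
    moreover have "ncont wt {0..\<tau>} u"
      using u sub unfolding wt.ncont_iff by (blast intro: continuous_on_subset)
    moreover have "u t n = S t u0 n + integral {0..t} (\<lambda>s. S (t - s) (Kop k s (u s)) n)"
      if "t \<in> {0..\<tau>}" "n \<ge> 1" for t n
      using mild sub that by blast
    ultimately show ?thesis
      using mild_imp_regular[of \<tau> u u0 k c c' \<theta> e] \<tau>(1) u0w c'(1,2) e
      unfolding u'_def[abs_def] by (simp add: less_imp_le)
  qed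
  have loc: "u t \<in> DG w a b \<and> l1 w (u' t) \<and>
      ((\<lambda>s. w.emb (u' s)) \<longlongrightarrow> w.emb (u' t)) (at t) \<and>
      ((\<lambda>s. (w.emb (u s) - w.emb (u t)) /\<^sub>R (s - t)) \<longlongrightarrow> w.emb (u' t)) (at t)"
    if t: "t \<in> interval_open tmax" for t
  proof -
    have t0: "0 < t" "ereal t < tmax" using t by (auto simp: interval_open_def)
    then obtain \<tau> where "ereal t < ereal \<tau>" and \<tau>: "ereal \<tau> < tmax"
      using ereal_dense2 by blast
    then have t\<tau>: "t < \<tau>" by simp
    \<comment> \<open>The cutoff \<open>e = t / 4\<close> makes the interval
      \<open>[t / 2, \<tau>]\<close>, with \<open>t\<close> in its interior, so that one-sided
      restrictions disappear from the limits.\<close>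
    have "t \<in> interior {2 * (t / 4)..\<tau>}" using t0 t\<tau> by simp
    then have at: "at t within {2 * (t / 4)..\<tau>} = at t" by (rule at_within_interior)
    have tin: "t \<in> {2 * (t / 4)..\<tau>}" using t0 t\<tau> by simp
    have r: "\<forall>t\<in>{2 * (t / 4)..\<tau>}. u t \<in> DG w a b" "ncont w {2 * (t / 4)..\<tau>} u'"
      "\<forall>r\<in>{2 * (t / 4)..\<tau>}. ((\<lambda>s. (w.emb (u s) - w.emb (u r)) /\<^sub>R (s - r)) \<longlongrightarrow> w.emb (u' r)) (at r within {2 * (t / 4)..\<tau>})"
      using reg[of \<tau> "t / 4"] t0 t\<tau> \<tau> by auto
    show ?thesis
    proof (intro conjI)
      show "u t \<in> DG w a b" using r(1) tin by blast
      show "l1 w (u' t)" using r(2) tin by (simp add: ncont_def)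
      show "((\<lambda>s. w.emb (u' s)) \<longlongrightarrow> w.emb (u' t)) (at t)"
        using r(2) tin unfolding w.ncont_iff continuous_on_def at[symmetric] by blast
      show "((\<lambda>s. (w.emb (u s) - w.emb (u t)) /\<^sub>R (s - t)) \<longlongrightarrow> w.emb (u' t)) (at t)"
        using bspec[OF r(3) tin] unfolding at .
    qed
  qed
  have ul: "l1 w (u t)" if "t \<in> interval_open tmax" for t
    using loc[OF that] DG_D(1) by blast
  have der: "((\<lambda>s. nrm w (\<lambda>n. (u s n - u t n) / (s - t) - u' t n)) \<longlongrightarrow> 0) (at t within interval_open tmax)"
    if t: "t \<in> interval_open tmax" for t
  proof -
    let ?I = "interval_open tmax"
    have ev: "\<forall>\<^sub>F s in at t within ?I. s \<in> ?I"
      by (simp add: eventually_at_filter)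
    have l: "\<forall>\<^sub>F s in at t within ?I. l1 w (\<lambda>n. (u s n - u t n) / (s - t))"
      using ev by eventually_elim (intro w.l1_divide w.l1_diff ul t)
    have "\<forall>\<^sub>F s in at t within ?I. (w.emb (u s) - w.emb (u t)) /\<^sub>R (s - t) = w.emb (\<lambda>n. (u s n - u t n) / (s - t))"
      using ev by eventually_elim (simp add: w.emb_divide w.emb_diff w.l1_diff ul t)
    moreover have "((\<lambda>s. (w.emb (u s) - w.emb (u t)) /\<^sub>R (s - t)) \<longlongrightarrow> w.emb (u' t)) (at t within ?I)"
      using loc[OF t] by (blast intro: tendsto_within_subset)
    ultimately have "((\<lambda>s. w.emb (\<lambda>n. (u s n - u t n) / (s - t))) \<longlongrightarrow> w.emb (u' t)) (at t within ?I)"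
      by (rule Lim_transform_eventually[rotated])
    then show ?thesis using w.tendsto_emb_iff[OF l, of "u' t"] loc[OF t] by blast
  qed
  have "ncont w (interval_open tmax) u'"
    unfolding w.ncont_iff continuous_on_def
    using loc by (blast intro: tendsto_within_subset)
  moreover have "eqv (u 0) u0"
  proof -
    have "0 \<in> interval0 tmax" using tm(1) by (simp add: interval0_def zero_ereal_def)
    then have "u 0 n = S 0 u0 n" if "n \<ge> 1" for n using mild[of 0 n] that by simp
    then show ?thesis using S_zero[OF u0w] by (simp add: eqv_def)
  qed
  ultimately show ?thesis
    unfolding classical_solution_def using u loc der
    by (intro conjI exI[of _ u']) (auto simp: eqv_def u'_def)
qed

end
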